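(* Let $X$ be a complete geodesic vector field on a Riemannian $3$-manifold $M$ of constant sectional curvature $c$, and for $p\in M$ let $\beta_p\colon X_p^\perp\to X_p^\perp$, $\beta_p(v)=\nabla_v X$. Then for every $p \in M$: \begin{itemize} \item If $c>0$, then $\beta_p$ does not admit any real eigenvalues. \item If $c=0$ and $\lambda$ is a real eigenvalue of $\beta_p$, then $\lambda=0$. \item If $c<0$ and $\lambda$ is a real eigenvalue of $\beta_p$, then $|\lambda|\le\sqrt{|c|}$. \end{itemize}
   Context: A vector field $X$ on a Riemannian manifold $(M,g)$ is called geodesic if it has unit length and $\nabla_X X=0$ (equivalently, all flow lines of $X$ are geodesics), where $\nabla$ is the Levi-Civita connection. $X_p^\perp\subset T_pM$ is the orthogonal complement of $X_p$; since $|X|\equiv 1$, the map $v\mapsto\nabla_v X$ takes values in $X_p^\perp$. "Complete" means that the flow of $X$ is defined for all times. *)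

theory Defs
  imports "HOL-Analysis.Analysis"
begin

section \<open>Smooth maps between normed vector spaces\<close>

primrec Ck_on :: "nat \<Rightarrow> 'a::real_normed_vector set \<Rightarrow> ('a \<Rightarrow> 'b::real_normed_vector) \<Rightarrow> bool" where
  "Ck_on 0 S f \<longleftrightarrow> continuous_on S f"
| "Ck_on (Suc k) S f \<longleftrightarrow>
     (\<forall>x\<in>S. f differentiable (at x)) \<and> (\<forall>v. Ck_on k S (\<lambda>x. frechet_derivative f (at x) v))"

text \<open>Only meaningful for open \<open>S\<close>; all uses below are of this kind.\<close>

definition smooth_on :: "'a::real_normed_vector set \<Rightarrow> ('a \<Rightarrow> 'b::real_normed_vector) \<Rightarrow> bool" where
  "smooth_on S f \<longleftrightarrow> (\<forall>k. Ck_on k S f)"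


section \<open>Smooth manifolds\<close>

text \<open>A chart is a domain together with a coordinate map, which is irrelevant outside the domain.
  The dimension of the manifold is \<open>CARD('n)\<close>.\<close>

type_synonym ('a, 'n) chart = "'a set \<times> ('a \<Rightarrow> real ^ 'n)"

definition is_chart :: "'a topology \<Rightarrow> ('a, 'n::finite) chart \<Rightarrow> bool" where
  "is_chart M = (\<lambda>(U, \<phi>). openin M U \<and> open (\<phi> ` U) \<and>
     homeomorphic_map (subtopology M U) (top_of_set (\<phi> ` U)) \<phi>)"

definition second_countable_space :: "'a topology \<Rightarrow> bool" where
  "second_countable_space M \<longleftrightarrow>
     (\<exists>\<B>. countable \<B> \<and> (\<forall>B\<in>\<B>. openin M B) \<and>
        (\<forall>U x. openin M U \<and> x \<in> U \<longrightarrow> (\<exists>B\<in>\<B>. x \<in> B \<and> B \<subseteq> U)))"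

text \<open>The smooth structure is given by a smooth atlas, not required to be maximal.\<close>

definition smooth_manifold :: "'a topology \<Rightarrow> ('a, 'n::finite) chart set \<Rightarrow> bool" where
  "smooth_manifold M A \<longleftrightarrow>
     Hausdorff_space M \<and> second_countable_space M \<and>
     (\<forall>C\<in>A. is_chart M C) \<and> topspace M = (\<Union>(U, \<phi>)\<in>A. U) \<and>
     (\<forall>(U, \<phi>)\<in>A. \<forall>(V, \<psi>)\<in>A. smooth_on (\<phi> ` (U \<inter> V)) (\<psi> \<circ> inv_into U \<phi>))"

text \<open>Smooth functions on an open set are total functions whose values off that set are ignored.\<close>

definition smooth_fun_on :: "'a topology \<Rightarrow> ('a, 'n::finite) chart set \<Rightarrow> 'a set \<Rightarrow> ('a \<Rightarrow> real) \<Rightarrow> bool" where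
  "smooth_fun_on M A U f \<longleftrightarrow> openin M U \<and>
     (\<forall>(V, \<phi>)\<in>A. smooth_on (\<phi> ` (U \<inter> V)) (f \<circ> inv_into V \<phi>))"

definition smooth_fun_at :: "'a topology \<Rightarrow> ('a, 'n::finite) chart set \<Rightarrow> 'a \<Rightarrow> ('a \<Rightarrow> real) \<Rightarrow> bool" where
  "smooth_fun_at M A p f \<longleftrightarrow> (\<exists>U. p \<in> U \<and> smooth_fun_on M A U f)"

definition smooth_curve_on :: "'a topology \<Rightarrow> ('a, 'n::finite) chart set \<Rightarrow> real set \<Rightarrow> (real \<Rightarrow> 'a) \<Rightarrow> bool" where
  "smooth_curve_on M A I \<gamma> \<longleftrightarrow> open I \<and> continuous_map (top_of_set I) M \<gamma> \<and>
     (\<forall>(V, \<phi>)\<in>A. smooth_on {t \<in> I. \<gamma> t \<in> V} (\<phi> \<circ> \<gamma>))"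


section \<open>Tangent vectors and vector fields\<close>

text \<open>A tangent vector at \<open>p\<close> is the velocity \<open>f \<mapsto> (f \<circ> \<gamma>)'(0)\<close> of a smooth curve \<open>\<gamma>\<close> through \<open>p\<close>,
  an operator on the functions that are smooth near \<open>p\<close>. It is given the value \<open>0\<close> on all other
  functions, so that equality of tangent vectors is equality in the function type.\<close>

type_synonym 'a tvec = "('a \<Rightarrow> real) \<Rightarrow> real"

definition velocity :: "'a topology \<Rightarrow> ('a, 'n::finite) chart set \<Rightarrow> (real \<Rightarrow> 'a) \<Rightarrow> real \<Rightarrow> 'a tvec" where
  "velocity M A \<gamma> t = (\<lambda>f. if smooth_fun_at M A (\<gamma> t) f then deriv (f \<circ> \<gamma>) t else 0)"

definition tangent_space :: "'a topology \<Rightarrow> ('a, 'n::finite) chart set \<Rightarrow> 'a \<Rightarrow> 'a tvec set" where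
  "tangent_space M A p =
     {velocity M A \<gamma> 0 | \<gamma>. \<exists>\<epsilon>>0. smooth_curve_on M A {-\<epsilon><..<\<epsilon>} \<gamma> \<and> \<gamma> 0 = p}"

abbreviation tzero :: "'a tvec" where
  "tzero \<equiv> (\<lambda>f. 0)"

abbreviation tadd :: "'a tvec \<Rightarrow> 'a tvec \<Rightarrow> 'a tvec" where
  "tadd v w \<equiv> (\<lambda>f. v f + w f)"

abbreviation tdiff :: "'a tvec \<Rightarrow> 'a tvec \<Rightarrow> 'a tvec" where
  "tdiff v w \<equiv> (\<lambda>f. v f - w f)"

abbreviation tscale :: "real \<Rightarrow> 'a tvec \<Rightarrow> 'a tvec" where
  "tscale a v \<equiv> (\<lambda>f. a * v f)"

definition vector_field_on :: "'a topology \<Rightarrow> ('a, 'n::finite) chart set \<Rightarrow> 'a set \<Rightarrow> ('a \<Rightarrow> 'a tvec) \<Rightarrow> bool" where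
  "vector_field_on M A U Y \<longleftrightarrow> openin M U \<and> (\<forall>p\<in>U. Y p \<in> tangent_space M A p) \<and>
     (\<forall>W f. W \<subseteq> U \<and> smooth_fun_on M A W f \<longrightarrow> smooth_fun_on M A W (\<lambda>p. Y p f))"

definition lie_bracket ::
  "'a topology \<Rightarrow> ('a, 'n::finite) chart set \<Rightarrow> ('a \<Rightarrow> 'a tvec) \<Rightarrow> ('a \<Rightarrow> 'a tvec) \<Rightarrow> 'a \<Rightarrow> 'a tvec" where
  "lie_bracket M A Y Z p =
     (\<lambda>f. if smooth_fun_at M A p f then Y p (\<lambda>q. Z q f) - Z p (\<lambda>q. Y q f) else 0)"


section \<open>Riemannian metrics, Levi-Civita connection, curvature\<close>

type_synonym 'a metric_tensor = "'a \<Rightarrow> 'a tvec \<Rightarrow> 'a tvec \<Rightarrow> real"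

definition riemannian_manifold ::
  "'a topology \<Rightarrow> ('a, 'n::finite) chart set \<Rightarrow> 'a metric_tensor \<Rightarrow> bool" where
  "riemannian_manifold M A g \<longleftrightarrow> smooth_manifold M A \<and>
     (\<forall>p\<in>topspace M. \<forall>u\<in>tangent_space M A p. \<forall>v\<in>tangent_space M A p.
        g p u v = g p v u \<and>
        (u \<noteq> tzero \<longrightarrow> g p u u > 0) \<and>
        (\<forall>a. g p (tscale a u) v = a * g p u v) \<and>
        (\<forall>w\<in>tangent_space M A p. g p (tadd u w) v = g p u v + g p w v)) \<and>
     (\<forall>U Y Z. vector_field_on M A U Y \<and> vector_field_on M A U Z \<longrightarrow>
        smooth_fun_on M A U (\<lambda>p. g p (Y p) (Z p)))"

text \<open>\<open>nabla p v Y\<close> is the covariant derivative at \<open>p\<close> of the vector field \<open>Y\<close> in the direction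
  \<open>v \<in> T\<^sub>pM\<close>. As is customary, a connection is applied to vector fields defined on an
  open neighbourhood of \<open>p\<close>, not only to global ones; its value on \<open>Y\<close> that is not a smooth vector
  field near \<open>p\<close> is arbitrary. The value depends only on the germ of \<open>Y\<close> at \<open>p\<close>: this follows from
  the Leibniz rule for functions \<open>f\<close> that are \<open>0\<close> near \<open>p\<close>, and need not be assumed.
  Homogeneity in \<open>Y\<close> is the Leibniz rule for constant \<open>f\<close>. That \<open>nabla\<close> takes a single direction
  \<open>v\<close> at \<open>p\<close> encodes linearity over the smooth functions in the direction argument.\<close>

type_synonym 'a covariant_derivative = "'a \<Rightarrow> 'a tvec \<Rightarrow> ('a \<Rightarrow> 'a tvec) \<Rightarrow> 'a tvec"

definition affine_connection ::
  "'a topology \<Rightarrow> ('a, 'n::finite) chart set \<Rightarrow> 'a covariant_derivative \<Rightarrow> bool" where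
  "affine_connection M A nabla \<longleftrightarrow>
     (\<forall>U V Y. vector_field_on M A U V \<and> vector_field_on M A U Y \<longrightarrow>
        vector_field_on M A U (\<lambda>p. nabla p (V p) Y)) \<and>
     (\<forall>U Y. vector_field_on M A U Y \<longrightarrow>
        (\<forall>p\<in>U. \<forall>v\<in>tangent_space M A p.
           nabla p v Y \<in> tangent_space M A p \<and>
           (\<forall>a. nabla p (tscale a v) Y = tscale a (nabla p v Y)) \<and>
           (\<forall>w\<in>tangent_space M A p. nabla p (tadd v w) Y = tadd (nabla p v Y) (nabla p w Y)) \<and>
           (\<forall>Z. vector_field_on M A U Z \<longrightarrow>
              nabla p v (\<lambda>q. tadd (Y q) (Z q)) = tadd (nabla p v Y) (nabla p v Z)) \<and>
           (\<forall>f. smooth_fun_on M A U f \<longrightarrow>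
              nabla p v (\<lambda>q. tscale (f q) (Y q)) =
                tadd (tscale (v f) (Y p)) (tscale (f p) (nabla p v Y)))))"

definition torsion_free ::
  "'a topology \<Rightarrow> ('a, 'n::finite) chart set \<Rightarrow> 'a covariant_derivative \<Rightarrow> bool" where
  "torsion_free M A nabla \<longleftrightarrow>
     (\<forall>U Y Z. vector_field_on M A U Y \<and> vector_field_on M A U Z \<longrightarrow>
        (\<forall>p\<in>U. tdiff (nabla p (Y p) Z) (nabla p (Z p) Y) = lie_bracket M A Y Z p))"

definition metric_compatible ::
  "'a topology \<Rightarrow> ('a, 'n::finite) chart set \<Rightarrow> 'a metric_tensor \<Rightarrow> 'a covariant_derivative \<Rightarrow> bool" where
  "metric_compatible M A g nabla \<longleftrightarrow>
     (\<forall>U Y Z. vector_field_on M A U Y \<and> vector_field_on M A U Z \<longrightarrow>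
        (\<forall>p\<in>U. \<forall>v\<in>tangent_space M A p.
           v (\<lambda>q. g q (Y q) (Z q)) = g p (nabla p v Y) (Z p) + g p (Y p) (nabla p v Z)))"

definition levi_civita_connection ::
  "'a topology \<Rightarrow> ('a, 'n::finite) chart set \<Rightarrow> 'a metric_tensor \<Rightarrow> 'a covariant_derivative \<Rightarrow> bool" where
  "levi_civita_connection M A g nabla \<longleftrightarrow>
     affine_connection M A nabla \<and> torsion_free M A nabla \<and> metric_compatible M A g nabla"

text \<open>Sign convention: \<open>R(Y,Z)W = \<nabla>\<^sub>Y\<nabla>\<^sub>ZW - \<nabla>\<^sub>Z\<nabla>\<^sub>YW - \<nabla>\<^bsub>[Y,Z]\<^esub>W\<close> and \<open>K(Y,Z)\<close> is proportional to
  \<open>g(R(Y,Z)Z,Y)\<close>, so that round spheres have positive curvature.\<close>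

definition curvature ::
  "'a topology \<Rightarrow> ('a, 'n::finite) chart set \<Rightarrow> 'a covariant_derivative \<Rightarrow>
     ('a \<Rightarrow> 'a tvec) \<Rightarrow> ('a \<Rightarrow> 'a tvec) \<Rightarrow> ('a \<Rightarrow> 'a tvec) \<Rightarrow> 'a \<Rightarrow> 'a tvec" where
  "curvature M A nabla Y Z W p =
     tdiff (tdiff (nabla p (Y p) (\<lambda>q. nabla q (Z q) W)) (nabla p (Z p) (\<lambda>q. nabla q (Y q) W)))
       (nabla p (lie_bracket M A Y Z p) W)"

definition sectional_curvature ::
  "'a topology \<Rightarrow> ('a, 'n::finite) chart set \<Rightarrow> 'a metric_tensor \<Rightarrow> 'a covariant_derivative \<Rightarrow>
     ('a \<Rightarrow> 'a tvec) \<Rightarrow> ('a \<Rightarrow> 'a tvec) \<Rightarrow> 'a \<Rightarrow> real" where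
  "sectional_curvature M A g nabla Y Z p =
     g p (curvature M A nabla Y Z Z p) (Y p) /
       (g p (Y p) (Y p) * g p (Z p) (Z p) - (g p (Y p) (Z p))\<^sup>2)"

text \<open>The sectional curvature of a plane in \<open>T\<^sub>pM\<close> is computed from local vector fields \<open>Y\<close>, \<open>Z\<close> whose
  values at \<open>p\<close> span the plane; the choice does not matter since the curvature is a tensor.\<close>

definition constant_sectional_curvature ::
  "'a topology \<Rightarrow> ('a, 'n::finite) chart set \<Rightarrow> 'a metric_tensor \<Rightarrow> 'a covariant_derivative \<Rightarrow> real \<Rightarrow> bool" where
  "constant_sectional_curvature M A g nabla c \<longleftrightarrow>
     (\<forall>U Y Z. vector_field_on M A U Y \<and> vector_field_on M A U Z \<longrightarrow>
        (\<forall>p\<in>U. (\<forall>a b. tadd (tscale a (Y p)) (tscale b (Z p)) = tzero \<longrightarrow> a = 0 \<and> b = 0) \<longrightarrow>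
           sectional_curvature M A g nabla Y Z p = c))"


section \<open>Geodesic vector fields\<close>

definition geodesic_vector_field ::
  "'a topology \<Rightarrow> ('a, 'n::finite) chart set \<Rightarrow> 'a metric_tensor \<Rightarrow> 'a covariant_derivative \<Rightarrow>
     ('a \<Rightarrow> 'a tvec) \<Rightarrow> bool" where
  "geodesic_vector_field M A g nabla X \<longleftrightarrow> vector_field_on M A (topspace M) X \<and>
     (\<forall>p\<in>topspace M. sqrt (g p (X p) (X p)) = 1 \<and> nabla p (X p) X = tzero)"

definition complete_vector_field ::
  "'a topology \<Rightarrow> ('a, 'n::finite) chart set \<Rightarrow> ('a \<Rightarrow> 'a tvec) \<Rightarrow> bool" where
  "complete_vector_field M A X \<longleftrightarrow>
     (\<forall>p\<in>topspace M. \<exists>\<gamma>. smooth_curve_on M A UNIV \<gamma> \<and> \<gamma> 0 = p \<and>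
        (\<forall>t. velocity M A \<gamma> t = X (\<gamma> t)))"

definition orth_complement ::
  "'a topology \<Rightarrow> ('a, 'n::finite) chart set \<Rightarrow> 'a metric_tensor \<Rightarrow> ('a \<Rightarrow> 'a tvec) \<Rightarrow> 'a \<Rightarrow> 'a tvec set" where
  "orth_complement M A g X p = {v \<in> tangent_space M A p. g p v (X p) = 0}"

definition \<beta> :: "'a covariant_derivative \<Rightarrow> ('a \<Rightarrow> 'a tvec) \<Rightarrow> 'a \<Rightarrow> 'a tvec \<Rightarrow> 'a tvec" where
  "\<beta> nabla X p v = nabla p v X"

definition real_eigenvalue :: "'a tvec set \<Rightarrow> ('a tvec \<Rightarrow> 'a tvec) \<Rightarrow> real \<Rightarrow> bool" where
  "real_eigenvalue S T l \<longleftrightarrow> (\<exists>v\<in>S. v \<noteq> tzero \<and> T v = tscale l v)"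

lemma beta_orth_complement:
  assumes g: "riemannian_manifold M A g" and lc: "levi_civita_connection M A g nabla"
    and X: "geodesic_vector_field M A g nabla X"
    and p: "p \<in> topspace M" and v: "v \<in> orth_complement M A g X p"
  shows "\<beta> nabla X p v \<in> orth_complement M A g X p"
proof -
  have Xf: "vector_field_on M A (topspace M) X"
    and unit: "\<And>q. q \<in> topspace M \<Longrightarrow> g q (X q) (X q) = 1"
    using X by (auto simp: geodesic_vector_field_def)
  have vT: "v \<in> tangent_space M A p"
    using v by (simp add: orth_complement_def)
  have XT: "X p \<in> tangent_space M A p"
    using Xf p by (simp add: vector_field_on_def)
  have nT: "nabla p v X \<in> tangent_space M A p"
    using lc Xf p vT unfolding levi_civita_connection_def affine_connection_def by blast
  have sym: "g p (X p) (nabla p v X) = g p (nabla p v X) (X p)"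
    using g XT nT p unfolding riemannian_manifold_def by blast
  obtain \<gamma> \<epsilon> where \<gamma>: "\<epsilon> > 0" "smooth_curve_on M A {-\<epsilon><..<\<epsilon>} \<gamma>" "v = velocity M A \<gamma> 0"
    using vT by (auto simp: tangent_space_def)
  have "\<gamma> t \<in> topspace M" if "t \<in> {-\<epsilon><..<\<epsilon>}" for t
    using \<gamma>(2) that by (auto simp: smooth_curve_on_def continuous_map_def)
  then have "\<forall>\<^sub>F t in nhds 0. ((\<lambda>q. g q (X q) (X q)) \<circ> \<gamma>) t = 1"
    using \<gamma>(1) unit by (auto simp: eventually_nhds intro!: exI[of _ "{-\<epsilon><..<\<epsilon>}"])
  then have "deriv ((\<lambda>q. g q (X q) (X q)) \<circ> \<gamma>) 0 = deriv (\<lambda>_. 1) 0"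
    by (intro deriv_cong_ev) auto
  then have "v (\<lambda>q. g q (X q) (X q)) = 0"
    by (simp add: \<gamma>(3) velocity_def)
  moreover have "v (\<lambda>q. g q (X q) (X q)) = g p (nabla p v X) (X p) + g p (X p) (nabla p v X)"
    using lc Xf p vT unfolding levi_civita_connection_def metric_compatible_def by blast
  ultimately show ?thesis
    using sym nT by (simp add: \<beta>_def orth_complement_def)
qed

end

theory Submission
  imports Defs
begin

text \<open>Along a flow line \<open>\<gamma>\<close> of \<open>X\<close> the endomorphism \<open>\<nabla>X\<close> satisfies a matrix Riccati equation, because
  \<open>R(V,X)X = c (V - g(V,X) X)\<close>. Taking traces gives a closed system for the trace \<open>h\<close> and the determinant
  \<open>d\<close> of \<open>\<beta>\<close>, namely \<open>h' = 2d - h\<^sup>2 - 2c\<close> and \<open>d' = -h (d + c)\<close>, valid for all times by completeness.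
  For an eigenvalue \<open>l\<close> of \<open>\<beta>\<close> at \<open>\<gamma>(0)\<close> let \<open>y'' = -c y\<close>, \<open>y(0) = 1\<close>, \<open>y'(0) = l\<close>. Then
  \<open>Q = y'\<^sup>2 - h y y' + d y\<^sup>2 = det (y' - y \<beta>)\<close> satisfies \<open>Q' = -h Q\<close> and \<open>Q(0) = 0\<close>, so \<open>Q = 0\<close>. At a zero of
  \<open>y\<close> this forces \<open>y' = 0\<close>, hence \<open>l\<^sup>2 + c = y'\<^sup>2 + c y\<^sup>2 = 0\<close>. But \<open>y\<close> has a zero as soon as
  \<open>l\<^sup>2 > -c\<close>.\<close>

section \<open>Calculus of smooth maps\<close>

text \<open>In a frame parallel along \<gamma> one has \<beta>' = -\<beta>^2 - c, hence (y' - y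
  \<beta>)' = -\<beta> (y' - y \<beta>), and Q' = -h Q is Liouville's formula for the determinant.
  The proof builds no parallel frame. It uses the full coordinate matrix B of V -> \<nabla>_V X on
  the 3-dimensional tangent space, whose derivative along \<gamma> carries an extra commutator with
  the connection coefficients. Traces of powers of B neither see this commutator nor depend on the
  chart, so they make sense along the whole flow line. Since X is in the kernel of V -> \<nabla>_V X
  and the image lies in the complement of X, one has det B = 0, h = tr B and d = (h^2 - tr B^2) / 2.
  Cayley-Hamilton then expresses tr B^3 through h and d, which closes the system. Constant sectional
  curvature prescribes only the quadratic form g(R(V,X)X, V). Passing to R(V,X)X itself is a
  polarization, and this needs g(R(V,X)X, W) to be symmetric in V and W.\<close>

lemma frechet_derivative_cong_open:
  assumes "open S" "x \<in> S" "\<And>y. y \<in> S \<Longrightarrow> f y = g y"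
  shows "frechet_derivative f (at x) = frechet_derivative g (at x)"
proof -
  have "(f has_derivative D) (at x) \<longleftrightarrow> (g has_derivative D) (at x)" for D
    using assms by (metis has_derivative_transform_within_open)
  then show ?thesis unfolding frechet_derivative_def by simp
qed

lemma differentiable_cong_open:
  assumes "open S" "x \<in> S" "\<And>y. y \<in> S \<Longrightarrow> f y = g y"
  shows "f differentiable (at x) \<longleftrightarrow> g differentiable (at x)"
  unfolding differentiable_def
  using assms by (metis has_derivative_transform_within_open)

lemma Ck_on_cong:
  assumes "open S" "\<And>x. x \<in> S \<Longrightarrow> f x = g x"
  shows "Ck_on k S f \<longleftrightarrow> Ck_on k S g"
  using assms(2)
proof (induction k arbitrary: f g)
  case 0
  then show ?case by (simp cong: continuous_on_cong)
next
  case (Suc k)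
  have "Ck_on k S (\<lambda>x. frechet_derivative f (at x) v) \<longleftrightarrow> Ck_on k S (\<lambda>x. frechet_derivative g (at x) v)" for v
    by (rule Suc.IH) (metis frechet_derivative_cong_open[OF assms(1)] Suc.prems)
  moreover have "(\<forall>x\<in>S. f differentiable (at x)) \<longleftrightarrow> (\<forall>x\<in>S. g differentiable (at x))"
    using differentiable_cong_open[OF assms(1)] Suc.prems by blast
  ultimately show ?case by simp
qed

lemma Ck_on_subset: "Ck_on k T f \<Longrightarrow> S \<subseteq> T \<Longrightarrow> Ck_on k S f"
  by (induction k arbitrary: f) (auto intro: continuous_on_subset)

lemma Ck_on_Suc: "Ck_on (Suc k) S f \<Longrightarrow> Ck_on k S f"
proof (induction k arbitrary: f)
  case 0
  then show ?case
    by (simp add: differentiable_imp_continuous_on differentiable_at_imp_differentiable_on)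
next
  case (Suc k)
  then show ?case by (metis Ck_on.simps(2))
qed

text \<open>\<open>Ck_on\<close> is phrased with \<open>frechet_derivative\<close>, a choice term.
  On an open set any explicit derivative may stand in for it, so a closure property only has to
  exhibit its product or chain rule formula.\<close>

lemma Ck_on_SucI:
  assumes "open S" and der: "\<And>x. x \<in> S \<Longrightarrow> (f has_derivative D x) (at x)"
    and D: "\<And>v. Ck_on k S (\<lambda>x. D x v)"
  shows "Ck_on (Suc k) S f"
proof -
  have "Ck_on k S (\<lambda>x. frechet_derivative f (at x) v)" for v
    using D[of v] by (subst Ck_on_cong[OF assms(1), of _ "\<lambda>x. D x v"])
      (simp_all add: frechet_derivative_at[OF der, symmetric])
  moreover have "\<forall>x\<in>S. f differentiable (at x)"
    using der by (auto simp: differentiable_def)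
  ultimately show ?thesis by simp
qed

lemma Ck_on_const: "Ck_on k S (\<lambda>x. c)"
  by (induction k arbitrary: c) auto

lemma Ck_on_bounded_linear:
  assumes "open S" "bounded_linear L" "Ck_on k S f"
  shows "Ck_on k S (\<lambda>x. L (f x))"
  using assms(3)
proof (induction k arbitrary: f)
  case 0
  then show ?case
    using bounded_linear.continuous_on[OF assms(2)] by simp
next
  case (Suc k)
  have der: "((\<lambda>x. L (f x)) has_derivative (\<lambda>v. L (frechet_derivative f (at x) v))) (at x)" if "x \<in> S" for x
    using Suc.prems that
    by (intro bounded_linear.has_derivative[OF assms(2)]) (auto simp: frechet_derivative_works)
  have "Ck_on k S (\<lambda>x. L (frechet_derivative f (at x) v))" for v
    using Suc by simp
  with der show ?case by (intro Ck_on_SucI[OF assms(1)])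
qed

lemma Ck_on_add:
  assumes "open S" "Ck_on k S f" "Ck_on k S g"
  shows "Ck_on k S (\<lambda>x. f x + g x)"
  using assms(2,3)
proof (induction k arbitrary: f g)
  case 0
  then show ?case by (simp add: continuous_on_add)
next
  case (Suc k)
  have der: "((\<lambda>x. f x + g x) has_derivative
      (\<lambda>v. frechet_derivative f (at x) v + frechet_derivative g (at x) v)) (at x)" if "x \<in> S" for x
    using Suc.prems that by (intro has_derivative_add) (auto simp: frechet_derivative_works)
  have "Ck_on k S (\<lambda>x. frechet_derivative f (at x) v + frechet_derivative g (at x) v)" for v
    using Suc by simp
  with der show ?case by (intro Ck_on_SucI[OF assms(1)])
qed

lemma Ck_on_scaleR:
  fixes f :: "'a::real_normed_vector \<Rightarrow> real" and g :: "'a \<Rightarrow> 'b::real_normed_vector"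
  assumes "open S" "Ck_on k S f" "Ck_on k S g"
  shows "Ck_on k S (\<lambda>x. f x *\<^sub>R g x)"
  using assms(2,3)
proof (induction k arbitrary: f g)
  case 0
  then show ?case by (simp add: continuous_on_scaleR)
next
  case (Suc k)
  have der: "((\<lambda>x. f x *\<^sub>R g x) has_derivative
      (\<lambda>v. f x *\<^sub>R frechet_derivative g (at x) v + frechet_derivative f (at x) v *\<^sub>R g x)) (at x)" if "x \<in> S" for x
    using Suc.prems that by (intro has_derivative_scaleR) (auto simp: frechet_derivative_works)
  have "Ck_on k S (\<lambda>x. f x *\<^sub>R frechet_derivative g (at x) v + frechet_derivative f (at x) v *\<^sub>R g x)" for v
    using Suc Ck_on_Suc[OF Suc.prems(1)] Ck_on_Suc[OF Suc.prems(2)]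
      by (intro Ck_on_add[OF assms(1)]) auto
  with der show ?case by (intro Ck_on_SucI[OF assms(1)])
qed

lemma Ck_on_sum:
  assumes "open S" "\<And>i. i \<in> I \<Longrightarrow> Ck_on k S (f i)"
  shows "Ck_on k S (\<lambda>x. \<Sum>i\<in>I. f i x)"
  using assms(2)
  by (induction I rule: infinite_finite_induct) (auto intro: Ck_on_const Ck_on_add[OF assms(1)])

text \<open>In the chain rule the direction fed to the derivative of \<open>f\<close> varies with
  the point, while \<open>Ck_on\<close> speaks of fixed directions. Expanding that direction in the
  standard basis gives a finite sum of products to which the induction hypothesis applies; hence the
  Euclidean space in the middle.\<close>

lemma Ck_on_compose:
  fixes g :: "'a::real_normed_vector \<Rightarrow> 'b::euclidean_space" and f :: "'b \<Rightarrow> 'c::real_normed_vector"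
  assumes "open S" "open T" "g ` S \<subseteq> T" "Ck_on k T f" "Ck_on k S g"
  shows "Ck_on k S (f \<circ> g)"
  using assms(4,5)
proof (induction k arbitrary: f)
  case 0
  then show ?case
    using assms(3) continuous_on_compose2[of T f S g] by (simp add: o_def)
next
  case (Suc k)
  have der: "((f \<circ> g) has_derivative
      (\<lambda>v. frechet_derivative f (at (g x)) (frechet_derivative g (at x) v))) (at x)" if "x \<in> S" for x
    using diff_chain_at[of g "frechet_derivative g (at x)" x f "frechet_derivative f (at (g x))"]
      Suc.prems that assms(3)
    by (auto simp: frechet_derivative_works o_def)
  have expand: "frechet_derivative f (at (g x)) (frechet_derivative g (at x) v) =
    (\<Sum>b\<in>Basis. (frechet_derivative g (at x) v \<bullet> b) *\<^sub>R (((\<lambda>z. frechet_derivative f (at z) b) \<circ> g) x))"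
    if "x \<in> S" for x v
  proof -
    have "linear (frechet_derivative f (at (g x)))"
      using Suc.prems that assms(3) by (auto intro!: linear_frechet_derivative)
    then show ?thesis
      by (subst euclidean_representation[symmetric, of "frechet_derivative g (at x) v"])
        (simp add: linear_sum linear_scale)
  qed
  have "Ck_on k S (\<lambda>x. \<Sum>b\<in>Basis. (frechet_derivative g (at x) v \<bullet> b) *\<^sub>R
        (((\<lambda>z. frechet_derivative f (at z) b) \<circ> g) x))" for v
    using Suc Ck_on_Suc[OF Suc.prems(2)]
      by (intro Ck_on_sum[OF assms(1)] Ck_on_scaleR[OF assms(1)]
          Ck_on_bounded_linear[OF assms(1) bounded_linear_inner_left]) (auto simp: o_def)
  moreover have "Ck_on k S (\<lambda>x. frechet_derivative f (at (g x)) (frechet_derivative g (at x) v)) \<longleftrightarrow>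
      Ck_on k S (\<lambda>x. \<Sum>b\<in>Basis. (frechet_derivative g (at x) v \<bullet> b) *\<^sub>R
        (((\<lambda>z. frechet_derivative f (at z) b) \<circ> g) x))" for v
    by (rule Ck_on_cong[OF assms(1)]) (rule expand)
  ultimately show ?case using der by (intro Ck_on_SucI[OF assms(1)]) blast+
qed

lemma smooth_on_cong:
  assumes "open S" "\<And>x. x \<in> S \<Longrightarrow> f x = g x"
  shows "smooth_on S f \<longleftrightarrow> smooth_on S g"
  using Ck_on_cong[OF assms] by (simp add: smooth_on_def)

lemma smooth_on_subset: "smooth_on T f \<Longrightarrow> S \<subseteq> T \<Longrightarrow> smooth_on S f"
  by (auto simp: smooth_on_def intro: Ck_on_subset)

lemma smooth_on_const: "smooth_on S (\<lambda>x. c)"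
  by (simp add: smooth_on_def Ck_on_const)

lemma smooth_on_bounded_linear:
  "open S \<Longrightarrow> bounded_linear L \<Longrightarrow> smooth_on S f \<Longrightarrow> smooth_on S (\<lambda>x. L (f x))"
  by (simp add: smooth_on_def Ck_on_bounded_linear)

lemma smooth_on_add:
  "open S \<Longrightarrow> smooth_on S f \<Longrightarrow> smooth_on S g \<Longrightarrow> smooth_on S (\<lambda>x. f x + g x)"
  by (simp add: smooth_on_def Ck_on_add)

lemma smooth_on_mult:
  fixes f g :: "'a::real_normed_vector \<Rightarrow> real"
  shows "open S \<Longrightarrow> smooth_on S f \<Longrightarrow> smooth_on S g \<Longrightarrow> smooth_on S (\<lambda>x. f x * g x)"
  using Ck_on_scaleR[of S _ f g] by (simp add: smooth_on_def)

lemma smooth_on_compose: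
  fixes g :: "'a::real_normed_vector \<Rightarrow> 'b::euclidean_space"
  shows "open S \<Longrightarrow> open T \<Longrightarrow> g ` S \<subseteq> T \<Longrightarrow> smooth_on T f \<Longrightarrow> smooth_on S g \<Longrightarrow> smooth_on S (f \<circ> g)"
  by (simp add: smooth_on_def Ck_on_compose)

lemma smooth_on_frechet_derivative:
  "smooth_on S f \<Longrightarrow> smooth_on S (\<lambda>x. frechet_derivative f (at x) v)"
  by (metis smooth_on_def Ck_on.simps(2))

lemma smooth_on_differentiable: "smooth_on S f \<Longrightarrow> x \<in> S \<Longrightarrow> f differentiable (at x)"
  by (metis smooth_on_def Ck_on.simps(2))

lemma smooth_on_affine:
  assumes "bounded_linear L"
  shows "smooth_on S (\<lambda>x. b + L x)"
proof -
  have der: "((\<lambda>x. b + L x) has_derivative L) (at x)" for x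
    using has_derivative_add[OF has_derivative_const bounded_linear_imp_has_derivative[OF assms]] by simp
  have "Ck_on k S (\<lambda>x. b + L x)" for k
  proof (cases k)
    case 0
    then show ?thesis
      using der by (auto intro!: has_derivative_continuous_on intro: has_derivative_at_withinI)
  next
    case (Suc j)
    then show ?thesis
      using der by (auto simp: differentiable_def Ck_on_const frechet_derivative_at[OF der, symmetric])
  qed
  then show ?thesis by (simp add: smooth_on_def)
qed

section \<open>Charts and tangent spaces\<close>

locale smooth_mfd =
  fixes M :: "'a topology" and A :: "('a, 'n::finite) chart set"
  assumes mfd: "smooth_manifold M A"
begin

lemma chart_openin: "(U, \<phi>) \<in> A \<Longrightarrow> openin M U"
  using mfd by (fastforce simp: smooth_manifold_def is_chart_def)

lemma chart_inj: "(U, \<phi>) \<in> A \<Longrightarrow> inj_on \<phi> U"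
proof -
  assume C: "(U, \<phi>) \<in> A"
  then have "homeomorphic_map (subtopology M U) (top_of_set (\<phi> ` U)) \<phi>"
    using mfd by (fastforce simp: smooth_manifold_def is_chart_def)
  then have "inj_on \<phi> (topspace (subtopology M U))"
    by (rule homeomorphic_imp_injective_map)
  moreover have "topspace (subtopology M U) = U"
    using chart_openin[OF C] openin_subset by (fastforce simp: topspace_subtopology)
  ultimately show ?thesis by simp
qed

lemma chart_inv: "(U, \<phi>) \<in> A \<Longrightarrow> p \<in> U \<Longrightarrow> inv_into U \<phi> (\<phi> p) = p"
  by (simp add: chart_inj inv_into_f_f)

lemma chart_open_image:
  assumes C: "(U, \<phi>) \<in> A" and W: "openin M W"
  shows "open (\<phi> ` (W \<inter> U))"
proof -
  have h: "homeomorphic_map (subtopology M U) (top_of_set (\<phi> ` U)) \<phi>" and o: "open (\<phi> ` U)"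
    using mfd C by (fastforce simp: smooth_manifold_def is_chart_def)+
  have "openin (subtopology M U) (W \<inter> U)"
    using W by (auto simp: openin_subtopology)
  then have "openin (top_of_set (\<phi> ` U)) (\<phi> ` (W \<inter> U))"
    using h homeomorphic_imp_open_map open_map_def by blast
  then show ?thesis using o openin_open_trans by blast
qed

lemma chart_transition:
  "(U, \<phi>) \<in> A \<Longrightarrow> (V, \<psi>) \<in> A \<Longrightarrow> smooth_on (\<phi> ` (U \<inter> V)) (\<psi> \<circ> inv_into U \<phi>)"
  using mfd by (fastforce simp: smooth_manifold_def)

lemma chart_at:
  assumes "p \<in> topspace M"
  obtains U \<phi> where "(U, \<phi>) \<in> A" "p \<in> U"
  using assms mfd by (auto simp: smooth_manifold_def)

section \<open>Smooth functions on the manifold\<close>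

lemma smooth_fun_on_subset:
  assumes "smooth_fun_on M A W f" "openin M V" "V \<subseteq> W"
  shows "smooth_fun_on M A V f"
  using assms unfolding smooth_fun_on_def
  by (auto elim!: smooth_on_subset dest!: bspec)

lemma smooth_fun_onD:
  "smooth_fun_on M A W f \<Longrightarrow> (U, \<phi>) \<in> A \<Longrightarrow> smooth_on (\<phi> ` (W \<inter> U)) (f \<circ> inv_into U \<phi>)"
  by (auto simp: smooth_fun_on_def)

lemma smooth_fun_onI:
  "openin M W \<Longrightarrow> (\<And>U \<phi>. (U, \<phi>) \<in> A \<Longrightarrow> smooth_on (\<phi> ` (W \<inter> U)) (f \<circ> inv_into U \<phi>))
    \<Longrightarrow> smooth_fun_on M A W f"
  by (auto simp: smooth_fun_on_def)

lemma smooth_fun_on_openin: "smooth_fun_on M A W f \<Longrightarrow> openin M W"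
  by (simp add: smooth_fun_on_def)

lemma smooth_fun_on_cong:
  assumes "smooth_fun_on M A W f" "\<And>q. q \<in> W \<Longrightarrow> f q = f' q"
  shows "smooth_fun_on M A W f'"
proof (rule smooth_fun_onI)
  show W: "openin M W" using assms(1) by (rule smooth_fun_on_openin)
  fix U \<phi> assume C: "(U, \<phi>) \<in> A"
  have "smooth_on (\<phi> ` (W \<inter> U)) (f \<circ> inv_into U \<phi>) \<longleftrightarrow> smooth_on (\<phi> ` (W \<inter> U)) (f' \<circ> inv_into U \<phi>)"
    using assms(2) chart_inv[OF C] by (intro smooth_on_cong chart_open_image[OF C W]) auto
  then show "smooth_on (\<phi> ` (W \<inter> U)) (f' \<circ> inv_into U \<phi>)"
    using smooth_fun_onD[OF assms(1) C] by simp
qed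

lemma smooth_fun_on_const: "openin M W \<Longrightarrow> smooth_fun_on M A W (\<lambda>q. c)"
  by (intro smooth_fun_onI) (auto simp: o_def smooth_on_const)

lemma smooth_fun_on_add:
  "smooth_fun_on M A W f \<Longrightarrow> smooth_fun_on M A W f' \<Longrightarrow> smooth_fun_on M A W (\<lambda>q. f q + f' q)"
  using smooth_on_add[OF chart_open_image smooth_fun_onD smooth_fun_onD] smooth_fun_on_openin
  by (intro smooth_fun_onI) (simp_all add: o_def)

lemma smooth_fun_on_mult:
  "smooth_fun_on M A W f \<Longrightarrow> smooth_fun_on M A W f' \<Longrightarrow> smooth_fun_on M A W (\<lambda>q. f q * f' q)"
  using smooth_on_mult[OF chart_open_image smooth_fun_onD smooth_fun_onD] smooth_fun_on_openin
  by (intro smooth_fun_onI) (simp_all add: o_def)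

lemma smooth_fun_on_diff:
  "smooth_fun_on M A W f \<Longrightarrow> smooth_fun_on M A W f' \<Longrightarrow> smooth_fun_on M A W (\<lambda>q. f q - f' q)"
  using smooth_fun_on_add[of W f "\<lambda>q. -1 * f' q"]
    smooth_fun_on_mult[OF smooth_fun_on_const[of W "-1"], of f'] smooth_fun_on_openin
  by simp

lemma smooth_fun_at_on: "smooth_fun_on M A W f \<Longrightarrow> p \<in> W \<Longrightarrow> smooth_fun_at M A p f"
  by (auto simp: smooth_fun_at_def)

lemma smooth_fun_atE:
  assumes "smooth_fun_at M A p f" "openin M V" "p \<in> V"
  obtains W where "smooth_fun_on M A W f" "p \<in> W" "W \<subseteq> V"
proof -
  obtain W where W: "p \<in> W" "smooth_fun_on M A W f" using assms by (auto simp: smooth_fun_at_def)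
  then have "smooth_fun_on M A (W \<inter> V) f"
    using smooth_fun_on_subset[of W f "W \<inter> V"] smooth_fun_on_openin assms by blast
  then show ?thesis using that[of "W \<inter> V"] W assms by blast
qed

lemma smooth_fun_at_cong:
  assumes "openin M W" "p \<in> W" "\<And>q. q \<in> W \<Longrightarrow> f q = f' q"
  shows "smooth_fun_at M A p f \<longleftrightarrow> smooth_fun_at M A p f'"
proof -
  have "smooth_fun_at M A p f'" if f: "smooth_fun_at M A p f" "\<And>q. q \<in> W \<Longrightarrow> f q = f' q" for f f'
  proof -
    obtain V where V: "smooth_fun_on M A V f" "p \<in> V" "V \<subseteq> W"
      using smooth_fun_atE[OF f(1) assms(1,2)] by blast
    show ?thesis
      using smooth_fun_on_cong[OF V(1), of f'] f(2) V smooth_fun_at_on by blast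
  qed
  from this[of f f'] this[of f' f] show ?thesis using assms(3) by auto
qed

text \<open>The tangent vector with components \<open>a\<close> in the chart \<open>C\<close>. The
  default 0 copies that of \<open>velocity\<close>, so that the two can be equal as
  functions.\<close>

definition coord_vec :: "('a, 'n) chart \<Rightarrow> 'a \<Rightarrow> real ^ 'n \<Rightarrow> 'a tvec" where
  "coord_vec C p a = (\<lambda>f. if smooth_fun_at M A p f
     then frechet_derivative (f \<circ> inv_into (fst C) (snd C)) (at (snd C p)) a else 0)"

context
  fixes U :: "'a set" and \<phi> :: "'a \<Rightarrow> real ^ 'n"
  assumes C: "(U, \<phi>) \<in> A"
begin

lemma chart_differentiable:
  assumes "p \<in> U" "smooth_fun_at M A p f"
  shows "(f \<circ> inv_into U \<phi>) differentiable (at (\<phi> p))"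
proof -
  obtain W where "smooth_fun_on M A W f" "p \<in> W" using assms by (auto simp: smooth_fun_at_def)
  then show ?thesis
    using smooth_on_differentiable[OF smooth_fun_onD[OF _ C]] assms by blast
qed

lemma linear_coord_vec: assumes "p \<in> U"
  shows "coord_vec (U, \<phi>) p (a + b) = tadd (coord_vec (U, \<phi>) p a) (coord_vec (U, \<phi>) p b)"
    "coord_vec (U, \<phi>) p (r *\<^sub>R a) = tscale r (coord_vec (U, \<phi>) p a)"
proof -
  have "linear (frechet_derivative (f \<circ> inv_into U \<phi>) (at (\<phi> p)))" if "smooth_fun_at M A p f" for f
    using chart_differentiable[OF assms that] by (rule linear_frechet_derivative)
  then show "coord_vec (U, \<phi>) p (a + b) = tadd (coord_vec (U, \<phi>) p a) (coord_vec (U, \<phi>) p b)"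
    "coord_vec (U, \<phi>) p (r *\<^sub>R a) = tscale r (coord_vec (U, \<phi>) p a)"
    by (auto simp: coord_vec_def linear_add linear_scale intro!: ext)
qed

lemma curve_chart_derivative:
  assumes \<gamma>: "smooth_curve_on M A I \<gamma>" and t: "t \<in> I" "\<gamma> t \<in> U" and f: "smooth_fun_at M A (\<gamma> t) f"
  shows "((f \<circ> \<gamma>) has_real_derivative
    coord_vec (U, \<phi>) (\<gamma> t) (vector_derivative (\<phi> \<circ> \<gamma>) (at t)) f) (at t)"
proof -
  \<comment> \<open>The factorization of \<open>f \<circ> \<gamma>\<close> through the chart is
    valid only while the curve is in \<open>U\<close>; openness of this set of times is what lets
    the derivative be transferred.\<close>
  let ?J = "{t \<in> I. \<gamma> t \<in> U}"
  have "openin (top_of_set I) {t \<in> topspace (top_of_set I). \<gamma> t \<in> U}"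
    using \<gamma> chart_openin[OF C] unfolding smooth_curve_on_def
    by (intro openin_continuous_map_preimage) auto
  then have J: "open ?J" using \<gamma> by (auto simp: smooth_curve_on_def intro: openin_open_trans)
  have "smooth_on ?J (\<phi> \<circ> \<gamma>)" using \<gamma> C by (auto simp: smooth_curve_on_def)
  then have "(\<phi> \<circ> \<gamma>) differentiable (at t)" by (rule smooth_on_differentiable) (use t in simp)
  then have 1: "((\<phi> \<circ> \<gamma>) has_vector_derivative vector_derivative (\<phi> \<circ> \<gamma>) (at t)) (at t)"
    by (simp add: vector_derivative_works)
  let ?F = "f \<circ> inv_into U \<phi>"
  have 2: "(?F has_derivative frechet_derivative ?F (at (\<phi> (\<gamma> t)))) (at ((\<phi> \<circ> \<gamma>) t))"
    using chart_differentiable[OF t(2) f] by (simp add: frechet_derivative_works)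
  have "((?F \<circ> (\<phi> \<circ> \<gamma>)) has_vector_derivative
      frechet_derivative ?F (at (\<phi> (\<gamma> t))) (vector_derivative (\<phi> \<circ> \<gamma>) (at t))) (at t)"
    using vector_derivative_diff_chain_within[OF 1 has_derivative_at_withinI[OF 2]]
    by (simp only: o_def)
  then have "((f \<circ> \<gamma>) has_vector_derivative
      frechet_derivative ?F (at (\<phi> (\<gamma> t))) (vector_derivative (\<phi> \<circ> \<gamma>) (at t))) (at t)"
    using J t chart_inv[OF C]
    by (elim has_vector_derivative_transform_within_open[where S = ?J]) auto
  then show ?thesis using f by (simp add: coord_vec_def has_real_derivative_iff_has_vector_derivative)
qed

lemma velocity_coord_vec:
  assumes \<gamma>: "smooth_curve_on M A I \<gamma>" and t: "t \<in> I" "\<gamma> t \<in> U"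
  shows "velocity M A \<gamma> t = coord_vec (U, \<phi>) (\<gamma> t) (vector_derivative (\<phi> \<circ> \<gamma>) (at t))"
  using DERIV_imp_deriv[OF curve_chart_derivative[OF assms]]
  by (auto simp: velocity_def coord_vec_def intro!: ext)

lemma coord_vec_in_tangent_space:
  assumes p: "p \<in> U"
  shows "coord_vec (U, \<phi>) p a \<in> tangent_space M A p"
proof -
  \<comment> \<open>The straight line through \<open>\<phi> p\<close> with direction
    \<open>a\<close>, pulled back by the chart; \<open>e\<close> is chosen so small that the line
    stays in the open image of the chart.\<close>
  define \<gamma> where "\<gamma> t = inv_into U \<phi> (\<phi> p + t *\<^sub>R a)" for t :: real
  have o: "open (\<phi> ` U)" using chart_open_image[OF C chart_openin[OF C]] by simp
  have "open ((\<lambda>t::real. \<phi> p + t *\<^sub>R a) -` (\<phi> ` U))"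
    by (intro open_vimage o continuous_intros)
  then obtain e where e: "e > 0" "ball 0 e \<subseteq> (\<lambda>t::real. \<phi> p + t *\<^sub>R a) -` (\<phi> ` U)"
    using p openE[of "(\<lambda>t::real. \<phi> p + t *\<^sub>R a) -` (\<phi> ` U)" 0] by auto
  have I: "\<phi> p + t *\<^sub>R a \<in> \<phi> ` U" if "t \<in> {-e<..<e}" for t
    using e(2) that by (auto simp: subset_iff dist_real_def abs_less_iff)
  have \<gamma>U: "\<gamma> t \<in> U" if "t \<in> {-e<..<e}" for t
    using I[OF that] by (auto simp: \<gamma>_def intro: inv_into_into)
  have \<phi>\<gamma>: "\<phi> (\<gamma> t) = \<phi> p + t *\<^sub>R a" if "t \<in> {-e<..<e}" for t
    using I[OF that] by (auto simp: \<gamma>_def f_inv_into_f)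
  have h: "homeomorphic_map (subtopology M U) (top_of_set (\<phi> ` U)) \<phi>"
    using mfd C by (fastforce simp: smooth_manifold_def is_chart_def)
  have preim: "open {t \<in> {-e<..<e}. \<gamma> t \<in> V}" if "openin M V" for V
  proof -
    have "open ({-e<..<e} \<inter> (\<lambda>t::real. \<phi> p + t *\<^sub>R a) -` (\<phi> ` (V \<inter> U)))"
      by (intro open_Int open_greaterThanLessThan open_vimage chart_open_image[OF C that] continuous_intros)
    also have "{-e<..<e} \<inter> (\<lambda>t::real. \<phi> p + t *\<^sub>R a) -` (\<phi> ` (V \<inter> U)) = {t \<in> {-e<..<e}. \<gamma> t \<in> V}"
      using chart_inv[OF C] \<gamma>U \<phi>\<gamma> by (auto simp: \<gamma>_def) (metis IntI image_eqI)
    finally show ?thesis .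
  qed
  have sub: "U \<subseteq> topspace M" using chart_openin[OF C] by (rule openin_subset)
  have "continuous_map (top_of_set {-e<..<e}) M \<gamma>"
    unfolding continuous_map_def
  proof (intro conjI allI impI)
    show "\<gamma> \<in> topspace (top_of_set {-e<..<e}) \<rightarrow> topspace M" using \<gamma>U sub by auto
    fix V assume "openin M V"
    from preim[OF this] show "openin (top_of_set {-e<..<e}) {t \<in> topspace (top_of_set {-e<..<e}). \<gamma> t \<in> V}"
      by (simp add: openin_open_eq) auto
  qed
  moreover have "smooth_on {t \<in> {-e<..<e}. \<gamma> t \<in> V} (\<psi> \<circ> \<gamma>)" if D: "(V, \<psi>) \<in> A" for V \<psi>
  proof -
    let ?J = "{t \<in> {-e<..<e}. \<gamma> t \<in> V}"
    have "smooth_on ?J ((\<psi> \<circ> inv_into U \<phi>) \<circ> (\<lambda>t. \<phi> p + t *\<^sub>R a))"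
    proof (rule smooth_on_compose)
      show "open ?J" using preim chart_openin[OF D] by blast
      show "open (\<phi> ` (U \<inter> V))" using chart_open_image[OF C chart_openin[OF D]] by (simp add: Int_commute)
      show "(\<lambda>t. \<phi> p + t *\<^sub>R a) ` ?J \<subseteq> \<phi> ` (U \<inter> V)" using \<phi>\<gamma> \<gamma>U by (force intro!: image_eqI)
      show "smooth_on (\<phi> ` (U \<inter> V)) (\<psi> \<circ> inv_into U \<phi>)" by (rule chart_transition[OF C D])
      show "smooth_on ?J (\<lambda>t. \<phi> p + t *\<^sub>R a)" by (rule smooth_on_affine) (rule bounded_linear_scaleR_left)
    qed
    then show ?thesis by (simp add: o_def \<gamma>_def)
  qed
  ultimately have curve: "smooth_curve_on M A {-e<..<e} \<gamma>" by (auto simp: smooth_curve_on_def)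
  have \<gamma>0: "\<gamma> 0 = p" using p by (simp add: \<gamma>_def chart_inv[OF C])
  have "((\<lambda>t. \<phi> p + t *\<^sub>R a) has_vector_derivative a) (at 0)"
    by (auto intro!: derivative_eq_intros)
  then have "((\<phi> \<circ> \<gamma>) has_vector_derivative a) (at 0)"
    using e(1) \<phi>\<gamma> by (elim has_vector_derivative_transform_within_open[where S = "{-e<..<e}"]) auto
  then have "velocity M A \<gamma> 0 = coord_vec (U, \<phi>) p a"
    using velocity_coord_vec[OF curve, of 0] e(1) p \<gamma>0 by (simp add: vector_derivative_at)
  then show ?thesis using curve \<gamma>0 e(1) unfolding tangent_space_def by (smt (verit) mem_Collect_eq)
qed

text \<open>Velocities of curves do not visibly form a vector space. This parametrization by
  components is the source of all linear algebra in tangent spaces.\<close>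

lemma tangent_space_eq: "p \<in> U \<Longrightarrow> tangent_space M A p = range (coord_vec (U, \<phi>) p)"
  using coord_vec_in_tangent_space
  by (auto simp: tangent_space_def velocity_coord_vec)

lemma smooth_coordinate: "smooth_fun_on M A U (\<lambda>q. \<phi> q $ i)"
proof (rule smooth_fun_onI[OF chart_openin[OF C]])
  fix V \<psi> assume D: "(V, \<psi>) \<in> A"
  have "smooth_on (\<psi> ` (U \<inter> V)) (\<lambda>x. (\<phi> \<circ> inv_into V \<psi>) x $ i)"
    using chart_transition[OF D C] chart_open_image[OF D chart_openin[OF C]]
    by (intro smooth_on_bounded_linear[OF _ bounded_linear_vec_nth]) (simp_all add: Int_commute o_def)
  then show "smooth_on (\<psi> ` (U \<inter> V)) ((\<lambda>q. \<phi> q $ i) \<circ> inv_into V \<psi>)" by (simp add: o_def)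
qed

lemma coord_vec_coordinate:
  assumes "p \<in> U"
  shows "coord_vec (U, \<phi>) p a (\<lambda>q. \<phi> q $ i) = a $ i"
proof -
  have "((\<lambda>x::real^'n. x $ i) has_derivative (\<lambda>x. x $ i)) (at (\<phi> p))"
    by (rule bounded_linear_imp_has_derivative[OF bounded_linear_vec_nth])
  then have "(((\<lambda>q. \<phi> q $ i) \<circ> inv_into U \<phi>) has_derivative (\<lambda>x. x $ i)) (at (\<phi> p))"
    using chart_open_image[OF C chart_openin[OF C]] assms
    by (elim has_derivative_transform_within_open[where s = "\<phi> ` U"]) (auto simp: chart_inv[OF C])
  then have "frechet_derivative ((\<lambda>q. \<phi> q $ i) \<circ> inv_into U \<phi>) (at (\<phi> p)) = (\<lambda>x. x $ i)"
    by (rule frechet_derivative_at[symmetric])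
  then show ?thesis
    using smooth_fun_at_on[OF smooth_coordinate assms] by (simp add: coord_vec_def)
qed

lemma vector_field_coord_vec: "vector_field_on M A U (\<lambda>p. coord_vec (U, \<phi>) p a)"
  unfolding vector_field_on_def
proof (intro conjI ballI allI impI)
  show "openin M U" by (rule chart_openin[OF C])
  show "\<And>p. p \<in> U \<Longrightarrow> coord_vec (U, \<phi>) p a \<in> tangent_space M A p" by (rule coord_vec_in_tangent_space)
  fix W f assume "W \<subseteq> U \<and> smooth_fun_on M A W f"
  then have WU: "W \<subseteq> U" and f: "smooth_fun_on M A W f" by auto
  have W: "openin M W" by (rule smooth_fun_on_openin[OF f])
  show "smooth_fun_on M A W (\<lambda>p. coord_vec (U, \<phi>) p a f)"
  proof (rule smooth_fun_onI[OF W])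
    fix V \<psi> assume D: "(V, \<psi>) \<in> A"
    let ?F = "\<lambda>z. frechet_derivative (f \<circ> inv_into U \<phi>) (at z) a"
    have o: "open (\<psi> ` (W \<inter> V))" by (rule chart_open_image[OF D W])
    \<comment> \<open>Read in another chart, the function is a directional derivative taken in the
      chart \<open>\<phi>\<close>, composed with the change of coordinates.\<close>
    have "smooth_on (\<psi> ` (W \<inter> V)) (?F \<circ> (\<phi> \<circ> inv_into V \<psi>))"
    proof (rule smooth_on_compose[OF o])
      show "open (\<phi> ` (W \<inter> U))" by (rule chart_open_image[OF C W])
      show "(\<phi> \<circ> inv_into V \<psi>) ` \<psi> ` (W \<inter> V) \<subseteq> \<phi> ` (W \<inter> U)"
        using WU by (auto simp: chart_inv[OF D])
      show "smooth_on (\<phi> ` (W \<inter> U)) ?F"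
        by (intro smooth_on_frechet_derivative smooth_fun_onD[OF f C])
      show "smooth_on (\<psi> ` (W \<inter> V)) (\<phi> \<circ> inv_into V \<psi>)"
        by (rule smooth_on_subset[OF chart_transition[OF D C]]) (use WU in auto)
    qed
    moreover have "(?F \<circ> (\<phi> \<circ> inv_into V \<psi>)) x = ((\<lambda>p. coord_vec (U, \<phi>) p a f) \<circ> inv_into V \<psi>) x"
      if "x \<in> \<psi> ` (W \<inter> V)" for x
      using that smooth_fun_at_on[OF f] by (auto simp: chart_inv[OF D] coord_vec_def)
    ultimately show "smooth_on (\<psi> ` (W \<inter> V)) ((\<lambda>p. coord_vec (U, \<phi>) p a f) \<circ> inv_into V \<psi>)"
      using smooth_on_cong[OF o] by blast
  qed
qed

end

lemma tangent_coord_vec: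
  assumes "(U, \<phi>) \<in> A" "p \<in> U" "v \<in> tangent_space M A p"
  obtains a where "v = coord_vec (U, \<phi>) p a"
  using assms(3) unfolding tangent_space_eq[OF assms(1,2)] by (rule imageE)

lemma
  assumes p: "p \<in> topspace M" and v: "v \<in> tangent_space M A p"
  shows tangent_scale: "tscale r v \<in> tangent_space M A p"
    and tangent_add: "w \<in> tangent_space M A p \<Longrightarrow> tadd v w \<in> tangent_space M A p"
proof -
  obtain U \<phi> where C: "(U, \<phi>) \<in> A" "p \<in> U" by (rule chart_at[OF p])
  obtain a where a: "v = coord_vec (U, \<phi>) p a" by (rule tangent_coord_vec[OF C v])
  show "tscale r v \<in> tangent_space M A p"
    using coord_vec_in_tangent_space[OF C, of "r *\<^sub>R a"] by (simp only: a linear_coord_vec(2)[OF C])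
  show "tadd v w \<in> tangent_space M A p" if w: "w \<in> tangent_space M A p"
  proof -
    obtain b where "w = coord_vec (U, \<phi>) p b" by (rule tangent_coord_vec[OF C w])
    then show ?thesis
      using coord_vec_in_tangent_space[OF C, of "a + b"] by (simp only: a linear_coord_vec(1)[OF C])
  qed
qed

lemma tangent_diff:
  assumes "p \<in> topspace M" "v \<in> tangent_space M A p" "w \<in> tangent_space M A p"
  shows "tdiff v w \<in> tangent_space M A p"
  using tangent_add[OF assms(1,2) tangent_scale[OF assms(1,3), of "-1"]] by (simp only: mult_minus1 add_uminus_conv_diff)

lemma tangent_zero:
  assumes p: "p \<in> topspace M"
  shows "tzero \<in> tangent_space M A p"
proof -
  obtain U \<phi> where C: "(U, \<phi>) \<in> A" "p \<in> U" by (rule chart_at[OF p])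
  show ?thesis
    using tangent_scale[OF p coord_vec_in_tangent_space[OF C], of 0] by simp
qed

lemma tangent_sum:
  assumes p: "p \<in> topspace M" and "finite I" and v: "\<And>i. i \<in> I \<Longrightarrow> v i \<in> tangent_space M A p"
  shows "(\<lambda>f. \<Sum>i\<in>I. a i * v i f) \<in> tangent_space M A p"
  using assms(2,3)
proof (induction I)
  case empty
  then show ?case using tangent_zero[OF p] by simp
next
  case (insert i I)
  have "tadd (tscale (a i) (v i)) (\<lambda>f. \<Sum>i\<in>I. a i * v i f) \<in> tangent_space M A p"
    by (rule tangent_add[OF p tangent_scale[OF p]]) (use insert in simp_all)
  then show ?case using insert by simp
qed

text \<open>Because of the default value 0, additivity is claimed only for functions smooth near
  \<open>p\<close>. Locality covers all functions: two functions that agree near \<open>p\<close>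
  are both smooth there or both not.\<close>

lemma
  assumes p: "p \<in> topspace M" and v: "v \<in> tangent_space M A p"
  shows tangent_apply_diff:
      "smooth_fun_at M A p f \<Longrightarrow> smooth_fun_at M A p f' \<Longrightarrow> v (\<lambda>q. f q - f' q) = v f - v f'"
    and tangent_apply_const: "v (\<lambda>q. c) = 0"
    and tangent_apply_cong: "openin M W \<Longrightarrow> p \<in> W \<Longrightarrow> (\<And>q. q \<in> W \<Longrightarrow> f q = f' q) \<Longrightarrow> v f = v f'"
proof -
  obtain U \<phi> where C: "(U, \<phi>) \<in> A" "p \<in> U" by (rule chart_at[OF p])
  obtain a where a: "v = coord_vec (U, \<phi>) p a" by (rule tangent_coord_vec[OF C v])
  show "v (\<lambda>q. f q - f' q) = v f - v f'" if f: "smooth_fun_at M A p f" "smooth_fun_at M A p f'"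
  proof -
    obtain W where W: "smooth_fun_on M A W f" "p \<in> W" using f by (auto simp: smooth_fun_at_def)
    obtain W' where W': "smooth_fun_on M A W' f'" "p \<in> W'" "W' \<subseteq> W"
      using smooth_fun_atE[OF f(2) smooth_fun_on_openin[OF W(1)] W(2)] by blast
    have "smooth_fun_on M A W' (\<lambda>q. f q - f' q)"
      using smooth_fun_on_diff smooth_fun_on_subset[OF W(1) smooth_fun_on_openin[OF W'(1)] W'(3)] W' by blast
    then have s: "smooth_fun_at M A p (\<lambda>q. f q - f' q)" using W' smooth_fun_at_on by blast
    let ?F = "f \<circ> inv_into U \<phi>" and ?F' = "f' \<circ> inv_into U \<phi>"
    have "((\<lambda>x. ?F x - ?F' x) has_derivative
      (\<lambda>x. frechet_derivative ?F (at (\<phi> p)) x - frechet_derivative ?F' (at (\<phi> p)) x)) (at (\<phi> p))"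
      using chart_differentiable[OF C] f by (intro has_derivative_diff) (auto simp only: frechet_derivative_works)
    from frechet_derivative_at[OF this, symmetric] show ?thesis
      using s f by (simp add: a coord_vec_def o_def)
  qed
  show "v (\<lambda>q. c) = 0" by (simp add: a coord_vec_def o_def)
  show "v f = v f'" if W: "openin M W" "p \<in> W" "\<And>q. q \<in> W \<Longrightarrow> f q = f' q"
  proof -
    have o: "open (\<phi> ` (W \<inter> U))" by (rule chart_open_image[OF C(1) W(1)])
    have "frechet_derivative (f \<circ> inv_into U \<phi>) (at (\<phi> p)) = frechet_derivative (f' \<circ> inv_into U \<phi>) (at (\<phi> p))"
      using W C by (intro frechet_derivative_cong_open[OF o]) (auto simp: chart_inv)
    then show ?thesis using smooth_fun_at_cong[OF W] by (simp add: a coord_vec_def)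
  qed
qed

section \<open>Algebra of vector fields on open sets\<close>

lemma field_openin: "vector_field_on M A U Y \<Longrightarrow> openin M U"
  by (simp add: vector_field_on_def)

lemma field_topspace: "vector_field_on M A U Y \<Longrightarrow> p \<in> U \<Longrightarrow> p \<in> topspace M"
  using openin_subset by (fastforce simp: vector_field_on_def)

lemma field_tangent: "vector_field_on M A U Y \<Longrightarrow> p \<in> U \<Longrightarrow> Y p \<in> tangent_space M A p"
  by (simp add: vector_field_on_def)

lemma field_apply_smooth:
  "vector_field_on M A U Y \<Longrightarrow> smooth_fun_on M A W f \<Longrightarrow> W \<subseteq> U \<Longrightarrow> smooth_fun_on M A W (\<lambda>p. Y p f)"
  by (simp add: vector_field_on_def)

lemma field_subset:
  "vector_field_on M A U Y \<Longrightarrow> openin M W \<Longrightarrow> W \<subseteq> U \<Longrightarrow> vector_field_on M A W Y"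
  unfolding vector_field_on_def by blast

lemma field_cong:
  assumes "vector_field_on M A U Y" "\<And>p. p \<in> U \<Longrightarrow> Y p = Y' p"
  shows "vector_field_on M A U Y'"
  unfolding vector_field_on_def
proof (intro conjI allI ballI impI)
  show "openin M U" using assms(1) by (rule field_openin)
  show "\<And>p. p \<in> U \<Longrightarrow> Y' p \<in> tangent_space M A p" using assms field_tangent by metis
  fix W f assume "W \<subseteq> U \<and> smooth_fun_on M A W f"
  then show "smooth_fun_on M A W (\<lambda>p. Y' p f)"
    using assms(2) smooth_fun_on_cong[OF field_apply_smooth[OF assms(1), of W f], of "\<lambda>p. Y' p f"]
    by (simp add: subset_iff)
qed

lemma field_add:
  assumes "vector_field_on M A U Y" "vector_field_on M A U Z"
  shows "vector_field_on M A U (\<lambda>p. tadd (Y p) (Z p))"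
  unfolding vector_field_on_def
proof (intro conjI allI ballI impI)
  show "openin M U" by (rule field_openin[OF assms(1)])
  show "tadd (Y p) (Z p) \<in> tangent_space M A p" if "p \<in> U" for p
    by (rule tangent_add[OF field_topspace[OF assms(1) that] field_tangent[OF assms(1) that] field_tangent[OF assms(2) that]])
  fix W f assume *: "W \<subseteq> U \<and> smooth_fun_on M A W f"
  show "smooth_fun_on M A W (\<lambda>p. Y p f + Z p f)"
    by (rule smooth_fun_on_add) (use * field_apply_smooth[OF assms(1)] field_apply_smooth[OF assms(2)] in simp_all)
qed

lemma field_scale:
  assumes "vector_field_on M A U Y" "smooth_fun_on M A U F"
  shows "vector_field_on M A U (\<lambda>p. tscale (F p) (Y p))"
  unfolding vector_field_on_def
proof (intro conjI allI ballI impI)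
  show "openin M U" by (rule field_openin[OF assms(1)])
  show "tscale (F p) (Y p) \<in> tangent_space M A p" if "p \<in> U" for p
    using tangent_scale[OF field_topspace[OF assms(1) that] field_tangent[OF assms(1) that]] .
  fix W f assume *: "W \<subseteq> U \<and> smooth_fun_on M A W f"
  then have W: "W \<subseteq> U" "smooth_fun_on M A W f" by simp_all
  show "smooth_fun_on M A W (\<lambda>p. F p * Y p f)"
  proof (rule smooth_fun_on_mult)
    show "smooth_fun_on M A W F"
      by (rule smooth_fun_on_subset[OF assms(2) smooth_fun_on_openin[OF W(2)] W(1)])
    show "smooth_fun_on M A W (\<lambda>p. Y p f)" by (rule field_apply_smooth[OF assms(1) W(2,1)])
  qed
qed

lemma field_diff:
  assumes "vector_field_on M A U Y" "vector_field_on M A U Z"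
  shows "vector_field_on M A U (\<lambda>p. tdiff (Y p) (Z p))"
  using field_add[OF assms(1) field_scale[OF assms(2) smooth_fun_on_const[OF field_openin[OF assms(1)], of "-1"]]]
  by simp

lemma field_zero: "openin M U \<Longrightarrow> vector_field_on M A U (\<lambda>p. tzero)"
  unfolding vector_field_on_def
  by (intro conjI ballI allI impI tangent_zero smooth_fun_on_const)
    (auto dest: openin_subset smooth_fun_on_openin)

lemma field_sum:
  assumes "openin M U" "finite I" "\<And>i. i \<in> I \<Longrightarrow> vector_field_on M A U (Y i)"
    "\<And>i. i \<in> I \<Longrightarrow> smooth_fun_on M A U (F i)"
  shows "vector_field_on M A U (\<lambda>p f. \<Sum>i\<in>I. F i p * Y i p f)"
  using assms(2-)
proof (induction I)
  case empty
  then show ?case using field_zero[OF assms(1)] by simp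
next
  case (insert i I)
  have "vector_field_on M A U (\<lambda>p. tadd (tscale (F i p) (Y i p)) (\<lambda>f. \<Sum>i\<in>I. F i p * Y i p f))"
    by (rule field_add[OF field_scale]) (use insert in simp_all)
  then show ?case using insert by simp
qed

end

section \<open>Metric and connection\<close>

locale riem_mfd = smooth_mfd M A
  for M :: "'a topology" and A :: "('a, 'n::finite) chart set" +
  fixes g :: "'a metric_tensor" and nabla :: "'a covariant_derivative"
  assumes rm: "riemannian_manifold M A g" and lc: "levi_civita_connection M A g nabla"
begin

context
  fixes p assumes p: "p \<in> topspace M"
begin

lemma metric_tensor_at:
  assumes "u \<in> tangent_space M A p" "v \<in> tangent_space M A p"
  shows "g p u v = g p v u \<and> (u \<noteq> tzero \<longrightarrow> g p u u > 0) \<and>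
    (\<forall>a. g p (tscale a u) v = a * g p u v) \<and>
    (\<forall>w\<in>tangent_space M A p. g p (tadd u w) v = g p u v + g p w v)"
  by (rule bspec[OF bspec[OF bspec[OF
    rm[unfolded riemannian_manifold_def, THEN conjunct2, THEN conjunct1] p] assms(1)] assms(2)])

lemmas metric_sym = metric_tensor_at[THEN conjunct1]

lemma metric_pos: "u \<in> tangent_space M A p \<Longrightarrow> u \<noteq> tzero \<Longrightarrow> g p u u > 0"
  by (rule metric_tensor_at[THEN conjunct2, THEN conjunct1, rule_format])

lemmas metric_scale_left = metric_tensor_at[THEN conjunct2, THEN conjunct2, THEN conjunct1, THEN spec]

lemma metric_add_left:
  "u \<in> tangent_space M A p \<Longrightarrow> w \<in> tangent_space M A p \<Longrightarrow> v \<in> tangent_space M A p \<Longrightarrow>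
    g p (tadd u w) v = g p u v + g p w v"
  by (rule metric_tensor_at[THEN conjunct2, THEN conjunct2, THEN conjunct2, THEN bspec])

lemma metric_diff_left:
  "u \<in> tangent_space M A p \<Longrightarrow> w \<in> tangent_space M A p \<Longrightarrow> v \<in> tangent_space M A p \<Longrightarrow>
    g p (tdiff u w) v = g p u v - g p w v"
  using metric_add_left[of u "tscale (-1) w" v] metric_scale_left[of w v "-1"] tangent_scale[OF p, of w "-1"]
  by simp

lemma metric_scale_right:
  "u \<in> tangent_space M A p \<Longrightarrow> v \<in> tangent_space M A p \<Longrightarrow> g p v (tscale a u) = a * g p v u"
  using metric_scale_left[of u v a] metric_sym[of v "tscale a u"] metric_sym[of v u] tangent_scale[OF p, of u a]
  by simp

lemma metric_add_right:
  "u \<in> tangent_space M A p \<Longrightarrow> w \<in> tangent_space M A p \<Longrightarrow> v \<in> tangent_space M A p \<Longrightarrow>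
    g p v (tadd u w) = g p v u + g p v w"
  using metric_add_left[of u w v] metric_sym[of v "tadd u w"] metric_sym[of v u] metric_sym[of v w]
    tangent_add[OF p, of u w] by simp

lemma metric_diff_right:
  "u \<in> tangent_space M A p \<Longrightarrow> w \<in> tangent_space M A p \<Longrightarrow> v \<in> tangent_space M A p \<Longrightarrow>
    g p v (tdiff u w) = g p v u - g p v w"
  using metric_diff_left[of u w v] metric_sym[of v "tdiff u w"] metric_sym[of v u] metric_sym[of v w]
    tangent_diff[OF p, of u w] by simp

lemma metric_zero_left: "v \<in> tangent_space M A p \<Longrightarrow> g p tzero v = 0"
  using metric_scale_left[of tzero v 0] tangent_zero[OF p] by simp

lemma metric_sum_left:
  assumes "finite I" "\<And>i. i \<in> I \<Longrightarrow> v i \<in> tangent_space M A p" "w \<in> tangent_space M A p"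
  shows "g p (\<lambda>f. \<Sum>i\<in>I. a i * v i f) w = (\<Sum>i\<in>I. a i * g p (v i) w)"
  using assms(1,2)
proof (induction I)
  case empty
  then show ?case using metric_zero_left assms(3) by simp
next
  case (insert i I)
  then show ?case
    using metric_add_left[OF tangent_scale[OF p, of "v i" "a i"] tangent_sum[OF p, of I v a] assms(3)]
      metric_scale_left[OF _ assms(3)] by simp
qed

end

lemma metric_smooth:
  assumes "vector_field_on M A U Y" "vector_field_on M A U Z"
  shows "smooth_fun_on M A U (\<lambda>p. g p (Y p) (Z p))"
  by (rule rm[unfolded riemannian_manifold_def, THEN conjunct2, THEN conjunct2, rule_format])
    (intro conjI assms)

lemma nabla_field:
  assumes "vector_field_on M A U V" "vector_field_on M A U Y"
  shows "vector_field_on M A U (\<lambda>p. nabla p (V p) Y)"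
  by (rule lc[unfolded levi_civita_connection_def affine_connection_def, THEN conjunct1, THEN conjunct1, rule_format])
    (intro conjI assms)

context
  fixes U Y p v
  assumes Y: "vector_field_on M A U Y" and p: "p \<in> U" and v: "v \<in> tangent_space M A p"
begin

lemma connection_at:
  "nabla p v Y \<in> tangent_space M A p \<and>
   (\<forall>a. nabla p (tscale a v) Y = tscale a (nabla p v Y)) \<and>
   (\<forall>w\<in>tangent_space M A p. nabla p (tadd v w) Y = tadd (nabla p v Y) (nabla p w Y)) \<and>
   (\<forall>Z. vector_field_on M A U Z \<longrightarrow>
      nabla p v (\<lambda>q. tadd (Y q) (Z q)) = tadd (nabla p v Y) (nabla p v Z)) \<and>
   (\<forall>f. smooth_fun_on M A U f \<longrightarrow>
      nabla p v (\<lambda>q. tscale (f q) (Y q)) = tadd (tscale (v f) (Y p)) (tscale (f p) (nabla p v Y)))"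
  by (rule lc[unfolded levi_civita_connection_def affine_connection_def, THEN conjunct1, THEN conjunct2,
      THEN spec, THEN spec, THEN mp, THEN bspec, THEN bspec, OF Y p v])

lemma nabla_tangent: "nabla p v Y \<in> tangent_space M A p"
  by (rule connection_at[THEN conjunct1])

lemma nabla_scale_dir: "nabla p (tscale a v) Y = tscale a (nabla p v Y)"
  by (rule connection_at[THEN conjunct2, THEN conjunct1, THEN spec])

lemma nabla_add_dir:
  "w \<in> tangent_space M A p \<Longrightarrow> nabla p (tadd v w) Y = tadd (nabla p v Y) (nabla p w Y)"
  by (rule connection_at[THEN conjunct2, THEN conjunct2, THEN conjunct1, THEN bspec])

lemma nabla_add_field:
  "vector_field_on M A U Z \<Longrightarrow> nabla p v (\<lambda>q. tadd (Y q) (Z q)) = tadd (nabla p v Y) (nabla p v Z)"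
  by (rule connection_at[THEN conjunct2, THEN conjunct2, THEN conjunct2, THEN conjunct1, THEN spec, THEN mp])

lemma nabla_leibniz:
  "smooth_fun_on M A U f \<Longrightarrow>
    nabla p v (\<lambda>q. tscale (f q) (Y q)) = tadd (tscale (v f) (Y p)) (tscale (f p) (nabla p v Y))"
  by (rule connection_at[THEN conjunct2, THEN conjunct2, THEN conjunct2, THEN conjunct2, THEN spec, THEN mp])

lemma metric_derivative:
  assumes Z: "vector_field_on M A U Z"
  shows "v (\<lambda>q. g q (Y q) (Z q)) = g p (nabla p v Y) (Z p) + g p (Y p) (nabla p v Z)"
  by (rule lc[unfolded levi_civita_connection_def metric_compatible_def, THEN conjunct2, THEN conjunct2,
      THEN spec, THEN spec, THEN spec, THEN mp, THEN bspec, THEN bspec, OF conjI[OF Y Z] p v])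

end

lemma nabla_diff_dir:
  assumes Y: "vector_field_on M A U Y" "p \<in> U" and v: "v \<in> tangent_space M A p" "w \<in> tangent_space M A p"
  shows "nabla p (tdiff v w) Y = tdiff (nabla p v Y) (nabla p w Y)"
  using nabla_add_dir[OF Y v(1) tangent_scale[OF field_topspace[OF Y] v(2), of "-1"]]
    nabla_scale_dir[OF Y v(2), of "-1"] by simp

lemma nabla_zero_dir:
  assumes Y: "vector_field_on M A U Y" "p \<in> U"
  shows "nabla p tzero Y = tzero"
  using nabla_scale_dir[OF Y tangent_zero[OF field_topspace[OF Y]], of 0] by simp

lemma nabla_zero_field:
  assumes "p \<in> topspace M" and v: "v \<in> tangent_space M A p"
  shows "nabla p v (\<lambda>q. tzero) = tzero"
proof -
  have o: "openin M (topspace M)" by simp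
  show ?thesis
  using nabla_leibniz[OF field_zero[OF o] assms smooth_fun_on_const[OF o, of 0]] by simp
qed

lemma nabla_cong:
  assumes Y: "vector_field_on M A W Y" and p: "p \<in> W" and v: "v \<in> tangent_space M A p"
    and eq: "\<And>q. q \<in> W \<Longrightarrow> Y q = Y' q"
  shows "nabla p v Y = nabla p v Y'"
proof -
  have o: "openin M W" by (rule field_openin[OF Y])
  \<comment> \<open>\<open>Y' - Y\<close> is the product of \<open>h\<close>, which vanishes on \<open>W\<close>, with a field that is zero on \<open>W\<close>.\<close>
  define h where "h q = (if q \<in> W then 0 else 1 :: real)" for q
  define Z where "Z q = tdiff (Y' q) (Y q)" for q
  have h: "smooth_fun_on M A W h"
    using smooth_fun_on_cong[OF smooth_fun_on_const[OF o, of 0], of h] by (simp add: h_def)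
  have Z: "vector_field_on M A W Z"
    by (rule field_cong[OF field_zero[OF o]]) (simp add: Z_def eq)
  have "Y' = (\<lambda>q. tadd (Y q) (tscale (h q) (Z q)))"
    using eq by (auto simp: h_def Z_def intro!: ext)
  then have "nabla p v Y' = tadd (nabla p v Y) (nabla p v (\<lambda>q. tscale (h q) (Z q)))"
    using nabla_add_field[OF Y p v field_scale[OF Z h]] by simp
  also have "nabla p v (\<lambda>q. tscale (h q) (Z q)) = tzero"
    using nabla_leibniz[OF Z p v h] p by (simp add: h_def Z_def eq)
  finally show ?thesis by simp
qed

lemma nabla_sum_dir:
  assumes Y: "vector_field_on M A U Y" "p \<in> U" and "finite I" "\<And>i. i \<in> I \<Longrightarrow> v i \<in> tangent_space M A p"
  shows "nabla p (\<lambda>f. \<Sum>i\<in>I. a i * v i f) Y = (\<lambda>f. \<Sum>i\<in>I. a i * nabla p (v i) Y f)"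
  using assms(3,4)
proof (induction I)
  case empty
  then show ?case using nabla_zero_dir[OF Y] by simp
next
  case (insert i I)
  have p: "p \<in> topspace M" by (rule field_topspace[OF Y])
  show ?case
    using insert nabla_add_dir[OF Y tangent_scale[OF p, of "v i" "a i"] tangent_sum[OF p, of I v a]]
      nabla_scale_dir[OF Y, of "v i" "a i"] by simp
qed

lemma nabla_sum_field:
  assumes U: "openin M U" "p \<in> U" and v: "v \<in> tangent_space M A p" and "finite I"
    and "\<And>i. i \<in> I \<Longrightarrow> vector_field_on M A U (Y i)" "\<And>i. i \<in> I \<Longrightarrow> smooth_fun_on M A U (F i)"
  shows "nabla p v (\<lambda>q f. \<Sum>i\<in>I. F i q * Y i q f)
    = (\<lambda>f. \<Sum>i\<in>I. v (F i) * Y i p f + F i p * nabla p v (Y i) f)"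
  using assms(4-)
proof (induction I)
  case empty
  have "p \<in> topspace M" using U openin_subset by blast
  then show ?case using nabla_zero_field[OF _ v] by simp
next
  case (insert i I)
  have 1: "vector_field_on M A U (\<lambda>q. tscale (F i q) (Y i q))" using insert by (intro field_scale) auto
  have 2: "vector_field_on M A U (\<lambda>q f. \<Sum>i\<in>I. F i q * Y i q f)"
    using insert U by (intro field_sum) auto
  show ?case
    using insert nabla_add_field[OF 1 U(2) v 2] nabla_leibniz[OF _ U(2) v, of "Y i" "F i"] by simp
qed

lemma lie_bracket_nabla:
  assumes "vector_field_on M A U Y" "vector_field_on M A U Z" "p \<in> U"
  shows "lie_bracket M A Y Z p = tdiff (nabla p (Y p) Z) (nabla p (Z p) Y)"
  by (rule lc[unfolded levi_civita_connection_def torsion_free_def, THEN conjunct2, THEN conjunct1,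
      THEN spec, THEN spec, THEN spec, THEN mp, THEN bspec, OF conjI[OF assms(1,2)] assms(3), symmetric])

text \<open>A tangent vector is the velocity of a curve, which a commutator of operators does not
  visibly provide. Torsion-freeness writes the bracket as a difference of two vector fields, and
  tangency and smoothness are inherited from these.\<close>

lemma lie_bracket_field:
  assumes Y: "vector_field_on M A U Y" "vector_field_on M A U Z"
  shows "vector_field_on M A U (lie_bracket M A Y Z)"
  by (rule field_cong[OF field_diff[OF nabla_field[OF Y] nabla_field[OF Y(2,1)]]])
    (simp add: lie_bracket_nabla[OF Y])

end

section \<open>Geodesic vector fields and curvature\<close>

context smooth_mfd
begin

lemma lie_bracket_bracket:
  assumes P: "vector_field_on M A U P" and Q: "vector_field_on M A U Q" and R: "vector_field_on M A U R"
    and p: "p \<in> U" and f: "smooth_fun_at M A p f"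
  shows "lie_bracket M A P (lie_bracket M A Q R) p f =
      P p (\<lambda>q. Q q (\<lambda>r. R r f)) - P p (\<lambda>q. R q (\<lambda>r. Q r f))
      - (Q p (\<lambda>q. R q (\<lambda>r. P r f)) - R p (\<lambda>q. Q q (\<lambda>r. P r f)))"
proof -
  obtain W where W: "smooth_fun_on M A W f" "p \<in> W" "W \<subseteq> U"
    using smooth_fun_atE[OF f field_openin[OF P] p] .
  have s: "smooth_fun_on M A W (\<lambda>q. Y q f')" if "vector_field_on M A U Y" "smooth_fun_on M A W f'" for Y f'
    using field_apply_smooth[OF that W(3)] .
  have at: "smooth_fun_at M A p f'" if "smooth_fun_on M A W f'" for f'
    using smooth_fun_at_on[OF that W(2)] .
  have o: "openin M W" by (rule smooth_fun_on_openin[OF W(1)])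
  have pM: "p \<in> topspace M" by (rule field_topspace[OF P p])
  have "P p (\<lambda>q. lie_bracket M A Q R q f) = P p (\<lambda>q. Q q (\<lambda>r. R r f) - R q (\<lambda>r. Q r f))"
    using smooth_fun_at_on[OF W(1)]
    by (intro tangent_apply_cong[OF pM field_tangent[OF P p] o W(2)]) (simp add: lie_bracket_def)
  also have "\<dots> = P p (\<lambda>q. Q q (\<lambda>r. R r f)) - P p (\<lambda>q. R q (\<lambda>r. Q r f))"
    by (rule tangent_apply_diff[OF pM field_tangent[OF P p] at[OF s[OF Q s[OF R W(1)]]] at[OF s[OF R s[OF Q W(1)]]]])
  finally show ?thesis
    using f at[OF s[OF P W(1)]] by (simp add: lie_bracket_def[of _ _ P] lie_bracket_def[of _ _ Q _ p])
qed

lemma lie_bracket_antisym: "lie_bracket M A Y Z p f = - lie_bracket M A Z Y p f"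
  by (simp add: lie_bracket_def)

text \<open>Leibniz form: bracketing with \<open>P\<close> is a derivation of the bracket. In this
  form the Lie derivative along \<open>X\<close> can be distributed over a bracket of two
  fields.\<close>

lemma jacobi_identity:
  assumes P: "vector_field_on M A U P" and Q: "vector_field_on M A U Q" and R: "vector_field_on M A U R"
    and p: "p \<in> U"
  shows "lie_bracket M A P (lie_bracket M A Q R) p =
    tadd (lie_bracket M A (lie_bracket M A P Q) R p) (lie_bracket M A Q (lie_bracket M A P R) p)"
proof
  fix f
  show "lie_bracket M A P (lie_bracket M A Q R) p f =
    lie_bracket M A (lie_bracket M A P Q) R p f + lie_bracket M A Q (lie_bracket M A P R) p f"
  proof (cases "smooth_fun_at M A p f")
    case True
    show ?thesis
      unfolding lie_bracket_antisym[of "lie_bracket M A P Q" R]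
        lie_bracket_bracket[OF P Q R p True] lie_bracket_bracket[OF R P Q p True]
        lie_bracket_bracket[OF Q P R p True]
      by simp
  qed (simp add: lie_bracket_def)
qed

end

section \<open>Geodesic fields: flow invariance of d\<alpha> and symmetry of V -> R(V,X)X\<close>

locale geodesic_field = riem_mfd M A g nabla
  for M :: "'a topology" and A :: "('a, 'n::finite) chart set" and g nabla +
  fixes X :: "'a \<Rightarrow> 'a tvec"
  assumes geodesic: "geodesic_vector_field M A g nabla X"
begin

lemma X_field: "openin M U \<Longrightarrow> vector_field_on M A U X"
  using geodesic field_subset[of "topspace M" X U] openin_subset by (auto simp: geodesic_vector_field_def)

lemma X_unit: "p \<in> topspace M \<Longrightarrow> g p (X p) (X p) = 1"
  using geodesic by (auto simp: geodesic_vector_field_def)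

lemma X_geodesic: "p \<in> topspace M \<Longrightarrow> nabla p (X p) X = tzero"
  using geodesic by (simp add: geodesic_vector_field_def)

lemma X_tangent: "p \<in> topspace M \<Longrightarrow> X p \<in> tangent_space M A p"
  by (rule field_tangent[OF X_field[OF openin_topspace]])

lemma nabla_X_orth:
  assumes p: "p \<in> topspace M" and v: "v \<in> tangent_space M A p"
  shows "g p (X p) (nabla p v X) = 0"
proof -
  note X = X_field[OF openin_topspace]
  have "v (\<lambda>q. g q (X q) (X q)) = v (\<lambda>q. 1)"
    by (rule tangent_apply_cong[OF p v openin_topspace p]) (rule X_unit)
  then have "g p (nabla p v X) (X p) + g p (X p) (nabla p v X) = 0"
    using metric_derivative[OF X p v X] tangent_apply_const[OF p v, of 1] by simp
  then show ?thesis using metric_sym[OF p X_tangent[OF p] nabla_tangent[OF X p v]] by simp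
qed

text \<open>For \<alpha> = g(X, .) this says that the Lie derivative of \<alpha> along
  \<open>X\<close> vanishes. Of the two unwanted terms, g(\<nabla>_X X, Z) is killed by the geodesic
  equation and g(X, \<nabla>_Z X) by unit length.\<close>

lemma bracket_X:
  assumes Z: "vector_field_on M A U Z" and p: "p \<in> U"
  shows "g p (X p) (lie_bracket M A X Z p) = X p (\<lambda>q. g q (X q) (Z q))"
proof -
  note X = X_field[OF field_openin[OF Z]]
  have pM: "p \<in> topspace M" by (rule field_topspace[OF Z p])
  show ?thesis
    using nabla_X_orth[OF pM field_tangent[OF Z p]] X_geodesic[OF pM]
      metric_derivative[OF X p field_tangent[OF X p] Z] metric_zero_left[OF pM field_tangent[OF Z p]]
      metric_diff_right[OF pM nabla_tangent[OF Z p X_tangent[OF pM]]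
        nabla_tangent[OF X p field_tangent[OF Z p]] X_tangent[OF pM]]
    by (simp add: lie_bracket_nabla[OF X Z p])
qed

text \<open>The twist is the exterior derivative of the one-form \<open>\<alpha> = g(X, \<cdot>)\<close>. Since \<open>X\<close> is geodesic of unit
  length, \<open>\<iota>\<^sub>X d\<alpha> = 0\<close> and so \<open>L\<^sub>X d\<alpha> = 0\<close>; this is what makes \<open>V \<mapsto> R(V,X)X\<close> symmetric, so the pair
  symmetry of the full curvature tensor is not needed.\<close>

abbreviation twist :: "('a \<Rightarrow> 'a tvec) \<Rightarrow> ('a \<Rightarrow> 'a tvec) \<Rightarrow> 'a \<Rightarrow> real" where
  "twist Y Z p \<equiv> g p (nabla p (Y p) X) (Z p) - g p (nabla p (Z p) X) (Y p)"

text \<open>Cartan's formula for d\<alpha>. Metric compatibility produces g(X, \<nabla>_Y Z) and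
  g(X, \<nabla>_Z Y), and torsion-freeness turns their difference into the bracket term.\<close>

lemma twist_eq:
  assumes Y: "vector_field_on M A U Y" and Z: "vector_field_on M A U Z" and p: "p \<in> U"
  shows "twist Y Z p = Y p (\<lambda>q. g q (X q) (Z q)) - Z p (\<lambda>q. g q (X q) (Y q))
      - g p (X p) (lie_bracket M A Y Z p)"
proof -
  note X = X_field[OF field_openin[OF Z]]
  have pM: "p \<in> topspace M" by (rule field_topspace[OF Z p])
  note Yt = field_tangent[OF Y p] and Zt = field_tangent[OF Z p]
  show ?thesis
    using metric_derivative[OF X p Yt Z] metric_derivative[OF X p Zt Y]
      metric_diff_right[OF pM nabla_tangent[OF Z p Yt] nabla_tangent[OF Y p Zt] X_tangent[OF pM]]
    by (simp add: lie_bracket_nabla[OF Y Z p])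
qed

text \<open>\<open>twist_eq\<close> reduces both sides to derivatives of \<alpha>(V), \<alpha>(W)
  and \<alpha>([V,W]). Then \<open>bracket_X\<close> replaces \<alpha>([X,Z]) by X(\<alpha>(Z))
  throughout, and the Jacobi identity takes care of the term with [V,W].\<close>

lemma twist_flow_invariant:
  assumes V: "vector_field_on M A U V" and W: "vector_field_on M A U W" and p: "p \<in> U"
  shows "X p (twist V W) = twist (lie_bracket M A X V) W p + twist V (lie_bracket M A X W) p"
proof -
  let ?a = "\<lambda>Z q. g q (X q) (Z q)"
  have o: "openin M U" by (rule field_openin[OF V])
  note X = X_field[OF o]
  have pM: "p \<in> topspace M" by (rule field_topspace[OF V p])
  note Xt = X_tangent[OF pM]
  have at: "smooth_fun_at M A p f" if "smooth_fun_on M A U f" for f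
    using smooth_fun_at_on[OF that p] .
  have a: "smooth_fun_on M A U (?a Z)" if "vector_field_on M A U Z" for Z
    by (rule metric_smooth[OF X that])
  note XV = lie_bracket_field[OF X V] and XW = lie_bracket_field[OF X W] and VW = lie_bracket_field[OF V W]
  have s: "smooth_fun_at M A p (\<lambda>q. Y q (?a Z))"
    if "vector_field_on M A U Y" "vector_field_on M A U Z" for Y Z
    by (rule at[OF field_apply_smooth[OF that(1) a[OF that(2)] order_refl]])
  have d: "smooth_fun_at M A p (\<lambda>q. V q (?a W) - W q (?a V))"
    by (rule at[OF smooth_fun_on_diff[OF field_apply_smooth[OF V a[OF W] order_refl]
          field_apply_smooth[OF W a[OF V] order_refl]]])
  have 1: "X p (twist V W) = X p (\<lambda>q. V q (?a W) - W q (?a V) - ?a (lie_bracket M A V W) q)"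
    by (intro tangent_apply_cong[OF pM Xt o p] twist_eq[OF V W])
  have 2: "\<dots> = X p (\<lambda>q. V q (?a W)) - X p (\<lambda>q. W q (?a V)) - X p (?a (lie_bracket M A V W))"
    using tangent_apply_diff[OF pM Xt d at[OF a[OF VW]]] tangent_apply_diff[OF pM Xt s[OF V W] s[OF W V]]
    by simp
  have 3: "W p (?a (lie_bracket M A X V)) = W p (\<lambda>q. X q (?a V))"
    by (rule tangent_apply_cong[OF pM field_tangent[OF W p] o p]) (rule bracket_X[OF V])
  have 4: "V p (?a (lie_bracket M A X W)) = V p (\<lambda>q. X q (?a W))"
    by (rule tangent_apply_cong[OF pM field_tangent[OF V p] o p]) (rule bracket_X[OF W])
  have 5: "lie_bracket M A X Z p (?a Y) = X p (\<lambda>q. Z q (?a Y)) - Z p (\<lambda>q. X q (?a Y))"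
    if "vector_field_on M A U Y" for Y Z
    using at[OF a[OF that]] by (simp add: lie_bracket_def)
  have 6: "?a (lie_bracket M A X (lie_bracket M A V W)) p =
     ?a (lie_bracket M A (lie_bracket M A X V) W) p + ?a (lie_bracket M A V (lie_bracket M A X W)) p"
    unfolding jacobi_identity[OF X V W p]
    by (intro metric_add_right[OF pM] field_tangent[OF lie_bracket_field p] XV XW V W Xt)
  show ?thesis
    unfolding 1 2 twist_eq[OF XV W p] twist_eq[OF V XW p] 3 4 5[OF W] 5[OF V]
    using 6 bracket_X[OF VW p] by simp
qed

lemma curvature_X:
  assumes V: "vector_field_on M A U V" and p: "p \<in> U"
  shows "curvature M A nabla V X X p =
    tdiff (tscale (-1) (nabla p (X p) (\<lambda>q. nabla q (V q) X))) (nabla p (lie_bracket M A V X p) X)"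
proof -
  have o: "openin M U" by (rule field_openin[OF V])
  have pM: "p \<in> topspace M" by (rule field_topspace[OF V p])
  \<comment> \<open>The inner field \<open>nabla q (X q) X\<close> is known to vanish only for
    \<open>q\<close> in the manifold, not as a function on the whole type, so the locality lemma
    \<open>nabla_cong\<close> is required.\<close>
  have "nabla p (V p) (\<lambda>q. tzero) = nabla p (V p) (\<lambda>q. nabla q (X q) X)"
    using X_geodesic openin_subset[OF o]
    by (intro nabla_cong[OF field_zero[OF o] p field_tangent[OF V p]]) auto
  then have "nabla p (V p) (\<lambda>q. nabla q (X q) X) = tzero"
    unfolding nabla_zero_field[OF pM field_tangent[OF V p]] by (rule sym)
  then show ?thesis by (simp add: curvature_def)
qed

text \<open>The terms are arranged for antisymmetrization in \<open>V\<close> and \<open>W\<close>: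
  the first becomes the \<open>X\<close>-derivative of \<open>twist V W\<close> up to sign, the next
  two become the two twists of \<open>twist_flow_invariant\<close>, and the last is symmetric and
  drops out.\<close>

lemma metric_curvature_X:
  assumes V: "vector_field_on M A U V" and W: "vector_field_on M A U W" and p: "p \<in> U"
  shows "g p (curvature M A nabla V X X p) (W p) =
    - X p (\<lambda>q. g q (nabla q (V q) X) (W q)) + g p (nabla p (V p) X) (lie_bracket M A X W p)
    + g p (nabla p (lie_bracket M A X V p) X) (W p) + g p (nabla p (V p) X) (nabla p (W p) X)"
proof -
  note X = X_field[OF field_openin[OF V]]
  have pM: "p \<in> topspace M" by (rule field_topspace[OF V p])
  note Vt = field_tangent[OF V p] and Wt = field_tangent[OF W p] and Xt = X_tangent[OF pM]
  note DV = nabla_field[OF V X]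
  note b1 = field_tangent[OF lie_bracket_field[OF V X] p] and b2 = field_tangent[OF lie_bracket_field[OF X V] p]
  have "lie_bracket M A V X p = tscale (-1) (lie_bracket M A X V p)"
    by (auto simp: lie_bracket_def)
  then have 1: "nabla p (lie_bracket M A V X p) X = tscale (-1) (nabla p (lie_bracket M A X V p) X)"
    using nabla_scale_dir[OF X p b2, of "-1"] by simp
  have 2: "X p (\<lambda>q. g q (nabla q (V q) X) (W q)) =
      g p (nabla p (X p) (\<lambda>q. nabla q (V q) X)) (W p) + g p (nabla p (V p) X) (nabla p (X p) W)"
    by (rule metric_derivative[OF DV p Xt W])
  have 3: "g p (nabla p (V p) X) (lie_bracket M A X W p) =
    g p (nabla p (V p) X) (nabla p (X p) W) - g p (nabla p (V p) X) (nabla p (W p) X)"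
    unfolding lie_bracket_nabla[OF X W p]
    by (intro metric_diff_right[OF pM] nabla_tangent[OF X p] nabla_tangent[OF W p] Vt Wt Xt)
  have 4: "g p (curvature M A nabla V X X p) (W p) =
     - g p (nabla p (X p) (\<lambda>q. nabla q (V q) X)) (W p) - - g p (nabla p (lie_bracket M A X V p) X) (W p)"
    unfolding curvature_X[OF V p] 1
    using metric_diff_left[OF pM tangent_scale[OF pM nabla_tangent[OF DV p Xt]]
        tangent_scale[OF pM nabla_tangent[OF X p b2]] Wt, of "-1" "-1"]
      metric_scale_left[OF pM nabla_tangent[OF DV p Xt] Wt, of "-1"]
      metric_scale_left[OF pM nabla_tangent[OF X p b2] Wt, of "-1"]
    by simp
  show ?thesis using 2 3 4 by simp
qed

lemma curvature_X_symmetric: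
  assumes V: "vector_field_on M A U V" and W: "vector_field_on M A U W" and p: "p \<in> U"
  shows "g p (curvature M A nabla V X X p) (W p) = g p (curvature M A nabla W X X p) (V p)"
proof -
  note X = X_field[OF field_openin[OF V]]
  have pM: "p \<in> topspace M" by (rule field_topspace[OF V p])
  note Vt = field_tangent[OF V p] and Wt = field_tangent[OF W p] and Xt = X_tangent[OF pM]
  have "X p (twist V W) = X p (\<lambda>q. g q (nabla q (V q) X) (W q)) - X p (\<lambda>q. g q (nabla q (W q) X) (V q))"
    by (rule tangent_apply_diff[OF pM Xt smooth_fun_at_on[OF metric_smooth[OF nabla_field[OF V X] W] p]
          smooth_fun_at_on[OF metric_smooth[OF nabla_field[OF W X] V] p]])
  moreover have "g p (nabla p (V p) X) (nabla p (W p) X) = g p (nabla p (W p) X) (nabla p (V p) X)"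
    by (intro metric_sym[OF pM] nabla_tangent[OF X p] Vt Wt)
  ultimately show ?thesis
    unfolding metric_curvature_X[OF V W p] metric_curvature_X[OF W V p]
    using twist_flow_invariant[OF V W p] by simp
qed

end

section \<open>Constant curvature: R(V,X)X and the Riccati equation\<close>

locale space_form_geodesic_field = geodesic_field M A g nabla X
  for M :: "'a topology" and A :: "('a, 'n::finite) chart set" and g nabla X +
  fixes c :: real
  assumes const_curv: "constant_sectional_curvature M A g nabla c"
begin

lemma curvature_X_tangent:
  assumes V: "vector_field_on M A U V" and p: "p \<in> U"
  shows "curvature M A nabla V X X p \<in> tangent_space M A p"
proof -
  note X = X_field[OF field_openin[OF V]]
  have pM: "p \<in> topspace M" by (rule field_topspace[OF V p])
  show ?thesis
    unfolding curvature_X[OF V p]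
    by (rule tangent_diff[OF pM tangent_scale[OF pM nabla_tangent[OF nabla_field[OF V X] p X_tangent[OF pM]]]
      nabla_tangent[OF X p field_tangent[OF lie_bracket_field[OF V X] p]]])
qed

text \<open>Symmetry turns this into g(R(X,X)X, V), and R(X,X)X vanishes.\<close>

lemma curvature_X_X:
  assumes V: "vector_field_on M A U V" and p: "p \<in> U"
  shows "g p (curvature M A nabla V X X p) (X p) = 0"
proof -
  have o: "openin M U" by (rule field_openin[OF V])
  note X = X_field[OF o]
  have pM: "p \<in> topspace M" by (rule field_topspace[OF V p])
  have "nabla p (X p) (\<lambda>q. tzero) = nabla p (X p) (\<lambda>q. nabla q (X q) X)"
    using X_geodesic openin_subset[OF o]
    by (intro nabla_cong[OF field_zero[OF o] p X_tangent[OF pM]]) auto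
  then have "nabla p (X p) (\<lambda>q. nabla q (X q) X) = tzero"
    unfolding nabla_zero_field[OF pM X_tangent[OF pM]] by (rule sym)
  moreover have "lie_bracket M A X X p = tzero" by (auto simp: lie_bracket_def intro!: ext)
  ultimately have "curvature M A nabla X X X p = tzero"
    using nabla_zero_dir[OF X p] by (simp add: curvature_def)
  then show ?thesis
    unfolding curvature_X_symmetric[OF V X p]
    using metric_zero_left[OF pM field_tangent[OF V p]] by simp
qed

text \<open>The curvature hypothesis speaks only of independent pairs. If \<open>V\<close> and
  \<open>X\<close> are dependent at \<open>p\<close>, then V = k X there and both sides vanish, the
  left one by \<open>curvature_X_X\<close>.\<close>

lemma metric_curvature_X_diag:
  assumes V: "vector_field_on M A U V" and p: "p \<in> U"
  shows "g p (curvature M A nabla V X X p) (V p) = c * (g p (V p) (V p) - (g p (X p) (V p))\<^sup>2)"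
proof -
  note X = X_field[OF field_openin[OF V]]
  have pM: "p \<in> topspace M" by (rule field_topspace[OF V p])
  note Vt = field_tangent[OF V p] and Xt = X_tangent[OF pM]
  let ?k = "g p (X p) (V p)"
  \<comment> \<open>The component of \<open>V p\<close> orthogonal to \<open>X p\<close>. Its
    squared length is the Gram determinant in the denominator of the sectional curvature, so it also
    decides between the two cases.\<close>
  let ?w = "tdiff (V p) (tscale ?k (X p))"
  note kX = tangent_scale[OF pM Xt, of ?k]
  have w: "?w \<in> tangent_space M A p" by (rule tangent_diff[OF pM Vt kX])
  have sym: "g p (V p) (X p) = ?k" by (rule metric_sym[OF pM Vt Xt])
  have ww: "g p ?w ?w = g p (V p) (V p) - ?k\<^sup>2"
    using metric_diff_left[OF pM Vt kX w] metric_diff_right[OF pM Vt kX Vt] metric_diff_right[OF pM Vt kX kX]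
      metric_scale_left[OF pM Xt Vt, of ?k] metric_scale_left[OF pM Xt kX, of ?k]
      metric_scale_right[OF pM Xt Vt, of ?k] metric_scale_right[OF pM Xt Xt, of ?k] X_unit[OF pM] sym
    by (simp add: power2_eq_square)
  show ?thesis
  proof (cases "?w = tzero")
    case True
    have "V p = tscale ?k (X p)"
    proof
      fix f show "V p f = ?k * X p f" using fun_cong[OF True, of f] by simp
    qed
    then have "g p (curvature M A nabla V X X p) (V p) = ?k * g p (curvature M A nabla V X X p) (X p)"
      using metric_scale_right[OF pM Xt curvature_X_tangent[OF V p], of ?k] by simp
    moreover have "g p (V p) (V p) - ?k\<^sup>2 = 0"
      using ww unfolding True metric_zero_left[OF pM tangent_zero[OF pM]] by simp
    ultimately show ?thesis using curvature_X_X[OF V p] by simp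
  next
    case False
    then have pos: "g p (V p) (V p) - ?k\<^sup>2 > 0" using metric_pos[OF pM w] ww by simp
    have "a = 0 \<and> b = 0" if ab: "tadd (tscale a (V p)) (tscale b (X p)) = tzero" for a b
    proof -
      have e: "a * V p f + b * X p f = 0" for f using fun_cong[OF ab, of f] by simp
      have "a = 0"
      proof (rule ccontr)
        assume a: "a \<noteq> 0"
        then have "V p = tscale (- b / a) (X p)"
        proof (intro ext)
          fix f show "V p f = - b / a * X p f" using e[of f] a by (simp add: field_simps)
        qed
        moreover from this have "?k = - b / a"
          using metric_scale_right[OF pM Xt Xt, of "- b / a"] X_unit[OF pM] by simp
        ultimately have "?w = tzero" by simp
        with False show False ..
      qed
      moreover from this have "b = 0"
      proof -
        have "X p \<noteq> tzero" using X_unit[OF pM] metric_zero_left[OF pM Xt] by auto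
        then obtain f where "X p f \<noteq> 0" by auto
        then show ?thesis using e[of f] \<open>a = 0\<close> by simp
      qed
      ultimately show ?thesis ..
    qed
    then have "sectional_curvature M A g nabla V X p = c"
      using const_curv[unfolded constant_sectional_curvature_def, THEN spec, THEN spec, THEN spec,
          THEN mp, THEN bspec, OF conjI[OF V X] p] by simp
    then show ?thesis
      using pos X_unit[OF pM] sym by (simp add: sectional_curvature_def field_simps)
  qed
qed

text \<open>Polarization: both sides are symmetric and additive in each argument, and they agree on
  the diagonal for V, W and V + W.\<close>

lemma metric_curvature_X_const:
  assumes V: "vector_field_on M A U V" and W: "vector_field_on M A U W" and p: "p \<in> U"
  shows "g p (curvature M A nabla V X X p) (W p) = c * (g p (V p) (W p) - g p (X p) (V p) * g p (X p) (W p))"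
proof -
  let ?S = "\<lambda>Y Z. g p (curvature M A nabla Y X X p) (Z p)"
  let ?Z = "\<lambda>q. tadd (V q) (W q)"
  have Z: "vector_field_on M A U ?Z" by (rule field_add[OF V W])
  have pM: "p \<in> topspace M" by (rule field_topspace[OF V p])
  note Vt = field_tangent[OF V p] and Wt = field_tangent[OF W p] and Xt = X_tangent[OF pM]
    and Zt = field_tangent[OF Z p]
  have add: "?S Y ?Z = ?S Y V + ?S Y W" if "vector_field_on M A U Y" for Y
    by (rule metric_add_right[OF pM Vt Wt curvature_X_tangent[OF that p]])
  have "?S ?Z ?Z = ?S V V + 2 * ?S V W + ?S W W"
    unfolding add[OF Z]
    unfolding curvature_X_symmetric[OF Z V p] curvature_X_symmetric[OF Z W p]
    unfolding add[OF V] add[OF W]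
    using curvature_X_symmetric[OF V W p] by simp
  moreover have "g p (?Z p) (?Z p) = g p (V p) (V p) + 2 * g p (V p) (W p) + g p (W p) (W p)"
    using metric_add_left[OF pM Vt Wt Zt] metric_add_right[OF pM Vt Wt Vt] metric_add_right[OF pM Vt Wt Wt]
      metric_sym[OF pM Vt Wt] by simp
  ultimately show ?thesis
    using metric_curvature_X_diag[OF V p] metric_curvature_X_diag[OF W p] metric_curvature_X_diag[OF Z p]
      metric_add_right[OF pM Vt Wt Xt]
    by (simp add: power2_eq_square algebra_simps)
qed

lemma curvature_X_const:
  assumes V: "vector_field_on M A U V" and p: "p \<in> U"
  shows "curvature M A nabla V X X p = tdiff (tscale c (V p)) (tscale (c * g p (X p) (V p)) (X p))"
proof -
  have pM: "p \<in> topspace M" by (rule field_topspace[OF V p])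
  let ?R = "curvature M A nabla V X X p" and ?k = "c * g p (X p) (V p)"
  let ?T = "tdiff (tscale c (V p)) (tscale ?k (X p))"
  note Vt = field_tangent[OF V p] and Xt = X_tangent[OF pM]
  note 1 = tangent_scale[OF pM Vt, of c] and 2 = tangent_scale[OF pM Xt, of ?k]
    and Rt = curvature_X_tangent[OF V p]
  have Tt: "?T \<in> tangent_space M A p" by (rule tangent_diff[OF pM 1 2])
  have Dt: "tdiff ?R ?T \<in> tangent_space M A p" by (rule tangent_diff[OF pM Rt Tt])
  obtain W \<phi> where C: "(W, \<phi>) \<in> A" "p \<in> W" by (rule chart_at[OF pM])
  \<comment> \<open>The difference is tested against itself. Since
    \<open>metric_curvature_X_const\<close> takes fields, this single vector is extended to the
    field with the same constant components in a chart.\<close>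
  obtain d where d: "tdiff ?R ?T = coord_vec (W, \<phi>) p d" by (rule tangent_coord_vec[OF C Dt])
  have UW: "openin M (U \<inter> W)" "p \<in> U \<inter> W" using field_openin[OF V] chart_openin[OF C(1)] p C(2) by auto
  have V': "vector_field_on M A (U \<inter> W) V" by (rule field_subset[OF V UW(1)]) simp
  have E: "vector_field_on M A (U \<inter> W) (\<lambda>q. coord_vec (W, \<phi>) q d)"
    by (rule field_subset[OF vector_field_coord_vec[OF C(1)] UW(1)]) simp
  have "g p ?R (tdiff ?R ?T) = g p ?T (tdiff ?R ?T)"
    using metric_curvature_X_const[OF V' E UW(2)] metric_diff_left[OF pM 1 2 Dt]
      metric_scale_left[OF pM Vt Dt, of c] metric_scale_left[OF pM Xt Dt, of ?k]
    unfolding d by (simp add: algebra_simps)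
  then have "g p (tdiff ?R ?T) (tdiff ?R ?T) = 0"
    using metric_diff_left[OF pM Rt Tt Dt] by simp
  then have D0: "tdiff ?R ?T = tzero" using metric_pos[OF pM Dt] by (cases "tdiff ?R ?T = tzero") simp_all
  show ?thesis
  proof
    fix f show "?R f = ?T f" using fun_cong[OF D0, of f] by simp
  qed
qed

text \<open>With A = \<nabla>X this is (\<nabla>_X A) V = - A^2 V - c (V - g(X,V) X). The last
  summand A(\<nabla>_X V) is the Leibniz correction from differentiating A V instead of A; it arises
  from [V,X] = \<nabla>_V X - \<nabla>_X V inside the curvature.\<close>

lemma riccati:
  assumes V: "vector_field_on M A U V" and p: "p \<in> U"
  shows "nabla p (X p) (\<lambda>q. nabla q (V q) X) f =
    - c * V p f + c * g p (X p) (V p) * X p f - nabla p (nabla p (V p) X) X f + nabla p (nabla p (X p) V) X f"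
proof -
  note X = X_field[OF field_openin[OF V]]
  have pM: "p \<in> topspace M" by (rule field_topspace[OF V p])
  note Vt = field_tangent[OF V p] and Xt = X_tangent[OF pM]
  have 1: "nabla p (lie_bracket M A V X p) X = tdiff (nabla p (nabla p (V p) X) X) (nabla p (nabla p (X p) V) X)"
    unfolding lie_bracket_nabla[OF V X p]
    by (rule nabla_diff_dir[OF X p nabla_tangent[OF X p Vt] nabla_tangent[OF V p Xt]])
  show ?thesis
    using fun_cong[OF trans[OF curvature_X[OF V p, symmetric] curvature_X_const[OF V p]], of f]
    unfolding 1 by simp
qed

end

section \<open>The Riccati equation in a chart\<close>

lemma matrix_diff_mult:
  fixes Z W :: "real ^ 'n ^ 'm" and Y :: "real ^ 'k ^ 'n"
  shows "(Z - W) ** Y = Z ** Y - W ** Y"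
  by (simp add: matrix_matrix_mult_def vec_eq_iff left_diff_distrib sum_subtractf)

lemma matrix_scaleR_mult:
  fixes Z :: "real ^ 'n ^ 'm" and Y :: "real ^ 'k ^ 'n"
  shows "(r *\<^sub>R Z) ** Y = r *\<^sub>R (Z ** Y)"
  by (simp add: matrix_matrix_mult_def vec_eq_iff sum_distrib_left mult.assoc)

lemma trace_scaleR:
  fixes Z :: "real ^ 'n ^ 'n"
  shows "trace (r *\<^sub>R Z) = r * trace Z"
  by (simp add: trace_def sum_distrib_left)

context smooth_mfd
begin

definition chart_frame :: "('a, 'n) chart \<Rightarrow> 'n \<Rightarrow> 'a \<Rightarrow> 'a tvec" where
  "chart_frame C i p = coord_vec C p (axis i 1)"

context
  fixes U :: "'a set" and \<phi> :: "'a \<Rightarrow> real ^ 'n"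
  assumes C: "(U, \<phi>) \<in> A"
begin

lemma frame_field: "vector_field_on M A U (chart_frame (U, \<phi>) i)"
  using vector_field_coord_vec[OF C, of "axis i 1"] by (simp add: chart_frame_def[abs_def])

lemma frame_tangent: "p \<in> U \<Longrightarrow> chart_frame (U, \<phi>) i p \<in> tangent_space M A p"
  by (rule field_tangent[OF frame_field])

lemma frame_coordinate: "p \<in> U \<Longrightarrow> chart_frame (U, \<phi>) i p (\<lambda>q. \<phi> q $ j) = (if j = i then 1 else 0)"
  by (simp add: chart_frame_def coord_vec_coordinate[OF C] axis_def)

lemma frame_expand:
  assumes p: "p \<in> U" and v: "v \<in> tangent_space M A p"
  shows "v = (\<lambda>f. \<Sum>i\<in>UNIV. v (\<lambda>q. \<phi> q $ i) * chart_frame (U, \<phi>) i p f)"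
proof
  fix f
  obtain a where a: "v = coord_vec (U, \<phi>) p a" by (rule tangent_coord_vec[OF C p v])
  have "linear (\<lambda>a. coord_vec (U, \<phi>) p a f)"
    by (rule linearI) (simp_all add: linear_coord_vec[OF C p])
  then have "coord_vec (U, \<phi>) p (\<Sum>i\<in>UNIV. a $ i *\<^sub>R axis i 1) f =
      (\<Sum>i\<in>UNIV. a $ i *\<^sub>R coord_vec (U, \<phi>) p (axis i 1) f)"
    by (simp only: linear_sum[of "\<lambda>a. coord_vec (U, \<phi>) p a f"] linear_scale[of "\<lambda>a. coord_vec (U, \<phi>) p a f"])
  moreover have "(\<Sum>i\<in>UNIV. a $ i *\<^sub>R axis i 1) = a"
    using basis_expansion[of a] by (simp add: scalar_mult_eq_scaleR)
  ultimately show "v f = (\<Sum>i\<in>UNIV. v (\<lambda>q. \<phi> q $ i) * chart_frame (U, \<phi>) i p f)"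
    by (simp add: a coord_vec_coordinate[OF C p] chart_frame_def)
qed

end

lemma smooth_fun_curve_derivative:
  assumes \<gamma>: "smooth_curve_on M A I \<gamma>" and t: "t \<in> I" and f: "smooth_fun_at M A (\<gamma> t) f"
  shows "((f \<circ> \<gamma>) has_real_derivative velocity M A \<gamma> t f) (at t)"
proof -
  have "\<gamma> t \<in> topspace M" using \<gamma> t by (auto simp: smooth_curve_on_def continuous_map_def)
  then obtain U \<phi> where C: "(U, \<phi>) \<in> A" "\<gamma> t \<in> U" by (rule chart_at)
  show ?thesis
    using curve_chart_derivative[OF C(1) \<gamma> t C(2) f] velocity_coord_vec[OF C(1) \<gamma> t C(2)] by simp
qed

end

context geodesic_field
begin

text \<open>Rows index the argument: the matrix acts on coordinate row vectors from the right.\<close>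

definition chart_matrix :: "('a, 'n) chart \<Rightarrow> 'a \<Rightarrow> real ^ 'n ^ 'n" where
  "chart_matrix C p = (\<chi> i j. nabla p (chart_frame C i p) X (\<lambda>q. snd C q $ j))"

context
  fixes U :: "'a set" and \<phi> :: "'a \<Rightarrow> real ^ 'n"
  assumes C: "(U, \<phi>) \<in> A"
begin

lemma nabla_X_coordinate:
  assumes p: "p \<in> U" and v: "v \<in> tangent_space M A p"
  shows "nabla p v X (\<lambda>q. \<phi> q $ j) = (\<Sum>i\<in>UNIV. v (\<lambda>q. \<phi> q $ i) * chart_matrix (U, \<phi>) p $ i $ j)"
proof -
  note X = X_field[OF chart_openin[OF C]]
  have "nabla p v X = (\<lambda>f. \<Sum>i\<in>UNIV. v (\<lambda>q. \<phi> q $ i) * nabla p (chart_frame (U, \<phi>) i p) X f)"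
    by (subst frame_expand[OF C p v]) (rule nabla_sum_dir[OF X p finite frame_tangent[OF C p]])
  then show ?thesis by (simp add: chart_matrix_def)
qed

lemma chart_matrix_smooth: "smooth_fun_on M A U (\<lambda>q. chart_matrix (U, \<phi>) q $ i $ j)"
  using field_apply_smooth[OF nabla_field[OF frame_field[OF C] X_field[OF chart_openin[OF C]]]
    smooth_coordinate[OF C] order_refl]
  by (simp add: chart_matrix_def)

lemma nabla_frame:
  assumes q: "q \<in> U"
  shows "nabla q (chart_frame (U, \<phi>) i q) X =
    (\<lambda>f. \<Sum>j\<in>UNIV. chart_matrix (U, \<phi>) q $ i $ j * chart_frame (U, \<phi>) j q f)"
  using frame_expand[OF C q nabla_tangent[OF X_field[OF chart_openin[OF C]] q frame_tangent[OF C q]]]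
  by (simp add: chart_matrix_def)

end

text \<open>Similar matrices have equal traces, and so have their squares; this makes the two traces
  independent of the chart.\<close>

lemma chart_matrix_change:
  assumes C: "(U, \<phi>) \<in> A" and D: "(V, \<psi>) \<in> A" and p: "p \<in> U" "p \<in> V"
  obtains P Q where "P ** Q = mat 1" "Q ** P = mat 1" "chart_matrix (V, \<psi>) p = P ** chart_matrix (U, \<phi>) p ** Q"
proof
  \<comment> \<open>The Jacobian matrix of the change of coordinates: row \<open>i\<close> holds the
    \<open>\<phi>\<close>-components of the \<open>i\<close>-th frame vector of the chart
    \<open>\<psi>\<close>.\<close>
  let ?P = "\<lambda>U \<phi> V \<psi>. (\<chi> i j. chart_frame (V, \<psi>) i p (\<lambda>q. \<phi> q $ j)) :: real ^ 'n ^ 'n"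
  have inv: "?P U \<phi> V \<psi> ** ?P V \<psi> U \<phi> = mat 1" if C: "(U, \<phi>) \<in> A" and D: "(V, \<psi>) \<in> A" and p: "p \<in> U" "p \<in> V"
    for U V \<phi> \<psi>
  proof -
    have "(\<Sum>k\<in>UNIV. chart_frame (V, \<psi>) i p (\<lambda>q. \<phi> q $ k) * chart_frame (U, \<phi>) k p (\<lambda>q. \<psi> q $ j)) =
      (if i = j then 1 else 0)" for i j
      using fun_cong[OF frame_expand[OF C p(1) frame_tangent[OF D p(2)]], of i "\<lambda>q. \<psi> q $ j"]
        frame_coordinate[OF D p(2), of i j] by auto
    then show ?thesis by (simp add: matrix_matrix_mult_def mat_def vec_eq_iff)
  qed
  show "?P U \<phi> V \<psi> ** ?P V \<psi> U \<phi> = mat 1" by (rule inv[OF C D p])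
  show "?P V \<psi> U \<phi> ** ?P U \<phi> V \<psi> = mat 1" by (rule inv[OF D C p(2,1)])
  note X = X_field[OF chart_openin[OF C]]
  have "chart_matrix (V, \<psi>) p $ i $ l = (?P U \<phi> V \<psi> ** (chart_matrix (U, \<phi>) p ** ?P V \<psi> U \<phi>)) $ i $ l" for i l
  proof -
    note Dt = frame_tangent[OF D p(2)]
    have "nabla p (chart_frame (V, \<psi>) i p) X =
        (\<lambda>f. \<Sum>j\<in>UNIV. chart_frame (V, \<psi>) i p (\<lambda>q. \<phi> q $ j) * nabla p (chart_frame (U, \<phi>) j p) X f)"
      by (subst frame_expand[OF C p(1) Dt[of i]]) (rule nabla_sum_dir[OF X p(1) finite frame_tangent[OF C p(1)]])
    then have "nabla p (chart_frame (V, \<psi>) i p) X (\<lambda>q. \<psi> q $ l) =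
        (\<Sum>j\<in>UNIV. chart_frame (V, \<psi>) i p (\<lambda>q. \<phi> q $ j) *
        (\<Sum>k\<in>UNIV. chart_matrix (U, \<phi>) p $ j $ k * chart_frame (U, \<phi>) k p (\<lambda>q. \<psi> q $ l)))"
      by (simp add: nabla_frame[OF C p(1)])
    then show ?thesis by (simp add: chart_matrix_def[of "(V, \<psi>)"] matrix_matrix_mult_def)
  qed
  then show "chart_matrix (V, \<psi>) p = ?P U \<phi> V \<psi> ** chart_matrix (U, \<phi>) p ** ?P V \<psi> U \<phi>"
    by (simp add: vec_eq_iff matrix_mul_assoc)
qed

lemma trace_chart_matrix_eq:
  assumes "(U, \<phi>) \<in> A" "(V, \<psi>) \<in> A" "p \<in> U" "p \<in> V"
  shows "trace (chart_matrix (V, \<psi>) p) = trace (chart_matrix (U, \<phi>) p)" (is "trace ?B' = trace ?B")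
    and "trace (chart_matrix (V, \<psi>) p ** chart_matrix (V, \<psi>) p) =
      trace (chart_matrix (U, \<phi>) p ** chart_matrix (U, \<phi>) p)"
proof -
  obtain P Q where PQ: "Q ** P = mat 1" and B': "?B' = P ** ?B ** Q"
    by (rule chart_matrix_change[OF assms])
  have conj: "trace (P ** Z ** Q) = trace Z" for Z
    using trace_mul_sym[of "P ** Z" Q] by (simp add: matrix_mul_assoc PQ)
  show "trace ?B' = trace ?B" by (simp add: B' conj)
  have "?B' ** ?B' = P ** (?B ** (Q ** P) ** ?B) ** Q"
    by (simp only: B' matrix_mul_assoc)
  then show "trace (?B' ** ?B') = trace (?B ** ?B)" by (simp add: PQ conj)
qed

end

section \<open>Matrix Riccati equation and derivatives of traces along a flow line\<close>

context space_form_geodesic_field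
begin

context
  fixes U :: "'a set" and \<phi> :: "'a \<Rightarrow> real ^ 'n"
  assumes C: "(U, \<phi>) \<in> A"
begin

abbreviation B :: "'a \<Rightarrow> real ^ 'n ^ 'n" where "B \<equiv> chart_matrix (U, \<phi>)"

text \<open>\<open>G\<close> holds the components of \<nabla>_X applied to the coordinate frame, and
  \<open>K\<close> is the matrix of the projection V -> g(X,V) X. The frame is not parallel, which
  accounts for the commutator of \<open>G\<close> and \<open>B p\<close>. The condition
  \<open>K ** B p = 0\<close> encodes the geodesic equation and \<open>trace K = 1\<close> the unit
  length of \<open>X\<close>.\<close>

lemma riccati_chart:
  assumes p: "p \<in> U"
  obtains G K :: "real ^ 'n ^ 'n" where
    "(\<chi> i k. X p (\<lambda>q. B q $ i $ k)) = G ** B p - B p ** G - B p ** B p - c *\<^sub>R (mat 1 - K)"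
    "K ** B p = 0" "trace K = 1"
proof
  let ?E = "chart_frame (U, \<phi>)" and ?x = "\<lambda>j q. \<phi> q $ j"
  let ?G = "(\<chi> i j. nabla p (X p) (?E i) (?x j)) :: real ^ 'n ^ 'n"
  let ?K = "(\<chi> i k. g p (X p) (?E i p) * X p (?x k)) :: real ^ 'n ^ 'n"
  have o: "openin M U" by (rule chart_openin[OF C])
  note X = X_field[OF o]
  have pM: "p \<in> topspace M" by (rule field_topspace[OF X p])
  note Et = frame_tangent[OF C p] and Xt = X_tangent[OF pM]
  have eq: "X p (\<lambda>q. B q $ i $ k) = (?G ** B p) $ i $ k - (B p ** ?G) $ i $ k - (B p ** B p) $ i $ k
      - c * (mat 1 $ i $ k - ?K $ i $ k)" for i k
  proof -
    have "nabla p (X p) (\<lambda>q. nabla q (?E i q) X) = nabla p (X p) (\<lambda>q f. \<Sum>j\<in>UNIV. B q $ i $ j * ?E j q f)"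
      by (rule nabla_cong[OF nabla_field[OF frame_field[OF C] X] p Xt nabla_frame[OF C]])
    also have "\<dots> = (\<lambda>f. \<Sum>j\<in>UNIV. X p (\<lambda>q. B q $ i $ j) * ?E j p f + B p $ i $ j * nabla p (X p) (?E j) f)"
      by (rule nabla_sum_field[OF o p Xt finite frame_field[OF C] chart_matrix_smooth[OF C]])
    finally have "nabla p (X p) (\<lambda>q. nabla q (?E i q) X) (?x k) =
        X p (\<lambda>q. B q $ i $ k) + (\<Sum>j\<in>UNIV. B p $ i $ j * ?G $ j $ k)"
      by (simp add: sum.distrib frame_coordinate[OF C p] if_distrib cong: if_cong)
    moreover have "nabla p (nabla p (?E i p) X) X (?x k) = (\<Sum>j\<in>UNIV. B p $ i $ j * B p $ j $ k)"
      using nabla_X_coordinate[OF C p nabla_tangent[OF X p Et]] by (simp add: chart_matrix_def)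
    moreover have "nabla p (nabla p (X p) (?E i)) X (?x k) = (\<Sum>j\<in>UNIV. ?G $ i $ j * B p $ j $ k)"
      using nabla_X_coordinate[OF C p nabla_tangent[OF frame_field[OF C] p Xt]] by simp
    ultimately show ?thesis
      using riccati[OF frame_field[OF C] p, of i "?x k"] frame_coordinate[OF C p, of i k]
      by (simp add: matrix_matrix_mult_def mat_def algebra_simps)
  qed
  show "(\<chi> i k. X p (\<lambda>q. B q $ i $ k)) = ?G ** B p - B p ** ?G - B p ** B p - c *\<^sub>R (mat 1 - ?K)"
    by (simp add: vec_eq_iff eq)
  have "(\<Sum>j\<in>UNIV. X p (?x j) * B p $ j $ k) = 0" for k
    using nabla_X_coordinate[OF C p Xt, of k] X_geodesic[OF pM] by simp
  then show "?K ** B p = 0"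
    by (simp add: vec_eq_iff matrix_matrix_mult_def mult.assoc sum_distrib_left[symmetric])
  have "g p (X p) (X p) = (\<Sum>j\<in>UNIV. X p (?x j) * g p (?E j p) (X p))"
    by (subst (1) frame_expand[OF C p Xt]) (rule metric_sum_left[OF pM finite Et Xt])
  then show "trace ?K = 1"
    using X_unit[OF pM] metric_sym[OF pM Et Xt] by (simp add: trace_def mult.commute)
qed

text \<open>\<open>X p\<close> is a nonzero kernel vector. In terms of \<open>K\<close>: an inverse
  of \<open>B p\<close> would turn \<open>K ** B p = 0\<close> into K = 0, against trace 1.\<close>

lemma det_chart_matrix:
  assumes "p \<in> U"
  shows "det (B p) = 0"
proof (rule ccontr)
  assume "det (B p) \<noteq> 0"
  then obtain Z where Z: "B p ** Z = mat 1" by (auto simp: invertible_def invertible_det_nz[symmetric])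
  obtain K :: "real ^ 'n ^ 'n" where K: "K ** B p = 0" "trace K = 1" by (rule riccati_chart[OF assms])
  have "K = K ** B p ** Z" by (simp add: matrix_mul_assoc[symmetric] Z)
  then have "K = 0" by (simp add: K(1))
  with K(2) show False by (simp add: trace_def)
qed

text \<open>The commutator with \<open>G\<close> has trace 0, also after multiplication by
  \<open>B\<close>, so the connection coefficients disappear. The factor
  \<open>real CARD('n) - 1\<close> is the trace of \<open>mat 1 - K\<close>; in the second equation
  \<open>K\<close> is annihilated by \<open>B\<close>.\<close>

lemma trace_chart_matrix_deriv:
  assumes \<gamma>: "smooth_curve_on M A UNIV \<gamma>" "velocity M A \<gamma> t = X (\<gamma> t)" and t: "\<gamma> t \<in> U"
  shows "((\<lambda>s. trace (B (\<gamma> s))) has_real_derivative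
      - trace (B (\<gamma> t) ** B (\<gamma> t)) - c * (real CARD('n) - 1)) (at t)"
    and "((\<lambda>s. trace (B (\<gamma> s) ** B (\<gamma> s))) has_real_derivative
      - 2 * (trace (B (\<gamma> t) ** B (\<gamma> t) ** B (\<gamma> t)) + c * trace (B (\<gamma> t)))) (at t)"
proof -
  let ?B = "B (\<gamma> t)"
  define B' where "B' = (\<chi> i k. X (\<gamma> t) (\<lambda>q. B q $ i $ k))"
  obtain G K where B': "B' = G ** ?B - ?B ** G - ?B ** ?B - c *\<^sub>R (mat 1 - K)"
    and K: "K ** ?B = 0" "trace K = 1"
    using riccati_chart[OF t] unfolding B'_def by metis
  have der: "((\<lambda>s. B (\<gamma> s) $ i $ k) has_real_derivative B' $ i $ k) (at t)" for i k
    using smooth_fun_curve_derivative[OF \<gamma>(1) UNIV_I smooth_fun_at_on[OF chart_matrix_smooth[OF C] t]]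
    by (simp add: B'_def \<gamma>(2) o_def)
  have "((\<lambda>s. trace (B (\<gamma> s))) has_real_derivative trace B') (at t)"
    unfolding trace_def by (intro DERIV_sum der)
  moreover have "trace B' = - trace (?B ** ?B) - c * (real CARD('n) - 1)"
    using trace_mul_sym[of G ?B] K(2)
    by (simp add: B' trace_sub trace_scaleR trace_I)
  ultimately show "((\<lambda>s. trace (B (\<gamma> s))) has_real_derivative
      - trace (?B ** ?B) - c * (real CARD('n) - 1)) (at t)" by simp
  have "((\<lambda>s. trace (B (\<gamma> s) ** B (\<gamma> s))) has_real_derivative
      (\<Sum>i\<in>UNIV. \<Sum>k\<in>UNIV. B' $ i $ k * ?B $ k $ i + B' $ k $ i * ?B $ i $ k)) (at t)"
    unfolding trace_def matrix_matrix_mult_def vec_lambda_beta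
    by (intro DERIV_sum DERIV_mult der)
  moreover have "(\<Sum>i\<in>UNIV. \<Sum>k\<in>UNIV. B' $ i $ k * ?B $ k $ i + B' $ k $ i * ?B $ i $ k) =
      trace (B' ** ?B) + trace (?B ** B')"
    by (simp add: trace_def matrix_matrix_mult_def sum.distrib mult.commute)
  moreover have "trace (B' ** ?B) = - (trace (?B ** ?B ** ?B) + c * trace ?B)"
  proof -
    have "B' ** ?B = G ** ?B ** ?B - ?B ** G ** ?B - ?B ** ?B ** ?B - c *\<^sub>R ?B"
      using K(1)
      by (simp add: B' matrix_diff_mult matrix_scaleR_mult)
    moreover have "trace (G ** ?B ** ?B) = trace (?B ** G ** ?B)"
      using trace_mul_sym[of "G ** ?B" ?B] by (simp add: matrix_mul_assoc)
    ultimately show ?thesis by (simp add: trace_sub trace_scaleR)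
  qed
  ultimately show "((\<lambda>s. trace (B (\<gamma> s) ** B (\<gamma> s))) has_real_derivative
      - 2 * (trace (?B ** ?B ** ?B) + c * trace ?B)) (at t)"
    using trace_mul_sym[of B' ?B] by simp
qed

end
end

section \<open>The Riccati equation for trace and determinant\<close>

text \<open>The trace of the Cayley-Hamilton equation with vanishing determinant. The fraction is
  the second elementary symmetric function of the eigenvalues.\<close>

lemma trace_cube_3:
  fixes B :: "real ^ 3 ^ 3"
  assumes "det B = 0"
  shows "trace (B ** B ** B) = trace B * trace (B ** B) - ((trace B)\<^sup>2 - trace (B ** B)) / 2 * trace B"
  using assms unfolding det_3 trace_def matrix_matrix_mult_def
  by (simp add: sum_3 power2_eq_square) algebra

text \<open>If \<open>x B = 0\<close> and \<open>u B = l u\<close> for row vectors, then the column \<open>n = x \<times> u\<close> is an eigenvector of \<open>B\<close> with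
  eigenvalue \<open>h - l\<close> and is annihilated by the adjugate \<open>B\<^sup>2 - h B + d\<close>.\<close>

lemma cross_product_eigen:
  fixes b11 :: real
  assumes n: "n1 = x2 * u3 - x3 * u2" "n2 = x3 * u1 - x1 * u3" "n3 = x1 * u2 - x2 * u1"
    and x: "x1 * b11 + x2 * b21 + x3 * b31 = 0" "x1 * b12 + x2 * b22 + x3 * b32 = 0"
      "x1 * b13 + x2 * b23 + x3 * b33 = 0"
    and u: "u1 * b11 + u2 * b21 + u3 * b31 = l * u1" "u1 * b12 + u2 * b22 + u3 * b32 = l * u2"
      "u1 * b13 + u2 * b23 + u3 * b33 = l * u3"
    and h: "h = b11 + b22 + b33"
    and d: "d = b11 * b22 - b12 * b21 + b11 * b33 - b13 * b31 + b22 * b33 - b23 * b32"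
  shows "(l\<^sup>2 - l * h + d) * n1 = 0"
proof -
  define m1 m2 m3 where m: "m1 = b11 * n1 + b12 * n2 + b13 * n3"
    "m2 = b21 * n1 + b22 * n2 + b23 * n3" "m3 = b31 * n1 + b32 * n2 + b33 * n3"
  \<comment> \<open>Here m = B n. The reason is the identity (x B) \<times> u + x \<times> (u B) =
    (h - B)(x \<times> u), whose left side is l n.\<close>
  have 1: "m1 = (h - l) * n1" "m2 = (h - l) * n2" "m3 = (h - l) * n3"
    using x u unfolding m n h by algebra+
  \<comment> \<open>First component of the identity adj(B) (x \<times> u) = (x B) \<times> (u B),
    with the adjugate written as B^2 - h B + d.\<close>
  have "b11 * m1 + b12 * m2 + b13 * m3 - h * m1 + d * n1 =
     (x1 * b12 + x2 * b22 + x3 * b32) * (u1 * b13 + u2 * b23 + u3 * b33)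
     - (x1 * b13 + x2 * b23 + x3 * b33) * (u1 * b12 + u2 * b22 + u3 * b32)"
    unfolding m n h d by algebra
  then have 2: "b11 * m1 + b12 * m2 + b13 * m3 - h * m1 + d * n1 = 0" using x by simp
  have "b11 * m1 + b12 * m2 + b13 * m3 = (h - l) * m1"
  proof -
    have "b11 * m1 + b12 * m2 + b13 * m3 = (h - l) * (b11 * n1 + b12 * n2 + b13 * n3)"
      by (simp add: 1 algebra_simps)
    then show ?thesis by (simp only: m(1))
  qed
  with 2 show ?thesis unfolding 1(1) by algebra
qed

text \<open>The characteristic polynomial of \<open>B\<close> is the variable times this quadratic,
  so a bare root argument says nothing when l = 0. The cross product of \<open>x\<close> and
  \<open>u\<close> handles all \<open>l\<close> alike: the value of the quadratic annihilates it,
  and it is nonzero because \<open>u\<close> and \<open>x\<close> are independent.\<close>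

lemma left_eigenvalue_3:
  fixes B :: "real ^ 3 ^ 3" and u x :: "real ^ 3"
  assumes u: "\<And>j. (\<Sum>i\<in>UNIV. u $ i * B $ i $ j) = l * u $ j"
    and x: "\<And>j. (\<Sum>i\<in>UNIV. x $ i * B $ i $ j) = 0"
    and indep: "\<And>a b. a *\<^sub>R u + b *\<^sub>R x = 0 \<Longrightarrow> a = 0 \<and> b = 0"
  shows "l\<^sup>2 - l * trace B + ((trace B)\<^sup>2 - trace (B ** B)) / 2 = 0"
proof (rule ccontr)
  let ?q = "l\<^sup>2 - l * trace B + ((trace B)\<^sup>2 - trace (B ** B)) / 2"
  assume q: "?q \<noteq> 0"
  let ?h = "B$1$1 + B$2$2 + B$3$3"
  let ?d = "B$1$1 * B$2$2 - B$1$2 * B$2$1 + B$1$1 * B$3$3 - B$1$3 * B$3$1 + B$2$2 * B$3$3 - B$2$3 * B$3$2"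
  have h: "trace B = ?h" by (simp add: trace_def sum_3)
  have "?q = l\<^sup>2 - l * ?h + ?d"
    by (simp add: trace_def matrix_matrix_mult_def sum_3 power2_eq_square field_simps)
  with q have q': "l\<^sup>2 - l * ?h + ?d \<noteq> 0" by simp
  note u3 = u[of 1, unfolded sum_3] u[of 2, unfolded sum_3] u[of 3, unfolded sum_3]
  note x3 = x[of 1, unfolded sum_3] x[of 2, unfolded sum_3] x[of 3, unfolded sum_3]
  have "(l\<^sup>2 - l * ?h + ?d) * (x$2 * u$3 - x$3 * u$2) = 0"
    by (rule cross_product_eigen[OF refl refl refl x3 u3 refl refl])
  then have 1: "x$2 * u$3 = x$3 * u$2" using q' by simp
  \<comment> \<open>\<open>cross_product_eigen\<close> treats the first component only. The other
    two follow by shifting the indices cyclically, under which trace and second symmetric function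
    are invariant.\<close>
  have "(l\<^sup>2 - l * ?h + ?d) * (x$3 * u$1 - x$1 * u$3) = 0"
    by (rule cross_product_eigen[OF refl refl refl, of "x$2" "B$2$2" "x$3" "B$3$2" "x$1" "B$1$2"
          "B$2$3" "B$3$3" "B$1$3" "B$2$1" "B$3$1" "B$1$1" "u$2" "u$3" "u$1" l])
      (use x3 u3 in \<open>simp_all add: algebra_simps\<close>)
  then have 2: "x$3 * u$1 = x$1 * u$3" using q' by simp
  have "(l\<^sup>2 - l * ?h + ?d) * (x$1 * u$2 - x$2 * u$1) = 0"
    by (rule cross_product_eigen[OF refl refl refl, of "x$3" "B$3$3" "x$1" "B$1$3" "x$2" "B$2$3"
          "B$3$1" "B$1$1" "B$2$1" "B$3$2" "B$1$2" "B$2$2" "u$3" "u$1" "u$2" l])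
      (use x3 u3 in \<open>simp_all add: algebra_simps\<close>)
  then have 3: "x$1 * u$2 = x$2 * u$1" using q' by simp
  have "x$i = 0" for i
  proof -
    have "(x$i) *\<^sub>R u + (- u$i) *\<^sub>R x = 0"
      using 1 2 3 exhaust_3[of i] by (auto simp: vec_eq_iff forall_3 algebra_simps)
    then show ?thesis using indep by blast
  qed
  then have "0 *\<^sub>R u + 1 *\<^sub>R x = 0" by (simp add: vec_eq_iff)
  with indep[of 0 1] show False by simp
qed

section \<open>Scalar differential equations\<close>

lemma linear_ode_zero:
  fixes Q H :: "real \<Rightarrow> real"
  assumes H: "continuous_on UNIV H" and Q: "\<And>t. (Q has_real_derivative - H t * Q t) (at t)" and Q0: "Q 0 = 0"
  shows "Q t = 0"
proof -
  \<comment> \<open>A compact interval containing both 0 and \<open>t\<close>, whatever the sign of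
    \<open>t\<close>. On it \<open>H\<close> has an antiderivative \<open>G\<close>, and
    \<open>exp (G s)\<close> is the integrating factor.\<close>
  define S where "S = {- \<bar>t\<bar>..\<bar>t\<bar>}"
  obtain G where G: "\<And>s. s \<in> S \<Longrightarrow> (G has_vector_derivative H s) (at s within S)"
    unfolding S_def using antiderivative_continuous[OF continuous_on_subset[OF H subset_UNIV]] by blast
  have "((\<lambda>s. Q s * exp (G s)) has_real_derivative 0) (at s within S)" if "s \<in> S" for s
    using DERIV_subset[OF Q[of s] subset_UNIV, of S]
      G[OF that, folded has_real_derivative_iff_has_vector_derivative]
    by (auto intro!: derivative_eq_intros simp: algebra_simps)
  then obtain k where "\<And>s. s \<in> S \<Longrightarrow> Q s * exp (G s) = k"
    using has_field_derivative_zero_constant[of S "\<lambda>s. Q s * exp (G s)"] by (auto simp: S_def)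
  moreover have "t \<in> S" "0 \<in> S" by (auto simp: S_def abs_if)
  ultimately have "Q t * exp (G t) = Q 0 * exp (G 0)" by metis
  then show ?thesis using Q0 by simp
qed

lemma riccati_eigenvalue_zero:
  fixes h d y z :: "real \<Rightarrow> real"
  assumes h: "\<And>t. (h has_real_derivative 2 * d t - (h t)\<^sup>2 - 2 * c) (at t)"
    and d: "\<And>t. (d has_real_derivative - h t * (d t + c)) (at t)"
    and y: "\<And>t. (y has_real_derivative z t) (at t)"
    and z: "\<And>t. (z has_real_derivative - c * y t) (at t)"
    and init: "y 0 = 1" "z 0 = l" "l\<^sup>2 - l * h 0 + d 0 = 0"
    and T: "y T = 0"
  shows "l\<^sup>2 + c = 0"
proof -
  define Q where "Q t = (z t)\<^sup>2 - h t * y t * z t + d t * (y t)\<^sup>2" for t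
  have Q: "(Q has_real_derivative - h t * Q t) (at t)" for t
    unfolding Q_def[abs_def]
    by (rule derivative_eq_intros h d y z refl)+ (simp add: algebra_simps power2_eq_square power3_eq_cube)
  have hc: "continuous_on UNIV h"
    using h by (auto intro: DERIV_isCont simp: continuous_on_eq_continuous_at)
  have "Q 0 = 0" using init by (simp add: Q_def mult.commute)
  with hc Q have "Q T = 0" by (rule linear_ode_zero)
  then have zT: "z T = 0" using T by (simp add: Q_def)
  have "((\<lambda>t. (z t)\<^sup>2 + c * (y t)\<^sup>2) has_real_derivative 0) (at t)" for t
    by (rule derivative_eq_intros y z refl)+ simp
  then have "(z T)\<^sup>2 + c * (y T)\<^sup>2 = (z 0)\<^sup>2 + c * (y 0)\<^sup>2"
    using DERIV_isconst_all[of "\<lambda>t. (z t)\<^sup>2 + c * (y t)\<^sup>2"] by blast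
  then show ?thesis using zT T init by simp
qed

text \<open>If the bound failed, the explicit solution of y'' = -c y with y(0) = 1 and y'(0) = l
  would have a zero. For c \<le> 0 that zero lies at negative time if l > 0 and at positive time if
  l < 0, so the equations must hold in both time directions.\<close>

lemma riccati_real_eigenvalue:
  fixes h d :: "real \<Rightarrow> real"
  assumes h: "\<And>t. (h has_real_derivative 2 * d t - (h t)\<^sup>2 - 2 * c) (at t)"
    and d: "\<And>t. (d has_real_derivative - h t * (d t + c)) (at t)"
    and l: "l\<^sup>2 - l * h 0 + d 0 = 0"
  shows "l\<^sup>2 \<le> - c"
proof -
  note zero = riccati_eigenvalue_zero[OF h d _ _ _ _ l]
  consider "c > 0" | "c = 0" | "c < 0" by linarith
  then show ?thesis
  proof cases
    case 1
    define k where "k = sqrt c"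
    have k: "k > 0" "c = k * k" using 1 by (simp_all add: k_def)
    let ?y = "\<lambda>t. cos (k * t) + l / k * sin (k * t)" and ?z = "\<lambda>t. - k * sin (k * t) + l * cos (k * t)"
    \<comment> \<open>\<open>?y\<close> equals 1 at 0 and -1 at \<open>pi / k\<close>, whatever
      \<open>l\<close> is.\<close>
    have "\<exists>T. 0 \<le> T \<and> T \<le> pi / k \<and> ?y T = 0"
      using k by (intro IVT2) (auto intro!: continuous_intros)
    then obtain T where T: "?y T = 0" by blast
    have "l\<^sup>2 + c = 0"
    proof (rule zero[of ?y ?z])
      show "(?y has_real_derivative ?z t) (at t)" for t
        using k by (auto intro!: derivative_eq_intros)
      show "(?z has_real_derivative - c * ?y t) (at t)" for t
        using k by (auto intro!: derivative_eq_intros simp: algebra_simps)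
    qed (use T in simp_all)
    then show ?thesis by simp
  next
    case 2
    show ?thesis
    proof (cases "l = 0")
      case False
      have "l\<^sup>2 + c = 0"
      proof (rule zero[of "\<lambda>t. 1 + l * t" "\<lambda>t. l"])
        show "1 + l * (- 1 / l) = 0" using False by simp
      qed (use 2 in \<open>auto intro!: derivative_eq_intros\<close>)
      then show ?thesis by simp
    qed (simp add: 2)
  next
    case 3
    define k where "k = sqrt (- c)"
    have k: "k > 0" "c = - (k * k)" using 3 by (simp_all add: k_def)
    show ?thesis
    proof (rule ccontr)
      assume "\<not> l\<^sup>2 \<le> - c"
      then have l2: "l\<^sup>2 > k\<^sup>2" by (simp add: k power2_eq_square)
      have pos: "(l - k) / (l + k) > 0"
      proof -
        have "(l - k) * (l + k) > 0" using l2 by (simp add: power2_eq_square algebra_simps)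
        then show ?thesis by (simp add: zero_less_divide_iff zero_less_mult_iff)
      qed
      then have lk: "l + k \<noteq> 0" by auto
      \<comment> \<open>This is cosh (k t) + (l / k) sinh (k t), split into exponentials so that its
        zero can be solved for.\<close>
      let ?y = "\<lambda>t. ((1 + l / k) * exp (k * t) + (1 - l / k) * exp (- (k * t))) / 2"
      let ?z = "\<lambda>t. ((k + l) * exp (k * t) - (k - l) * exp (- (k * t))) / 2"
      \<comment> \<open>Obtained from ?y T = 0, that is (l + k) exp (2 k T) = l - k. The logarithm
        makes sense exactly because l^2 > k^2 makes the quotient positive.\<close>
      define T where "T = ln ((l - k) / (l + k)) / (2 * k)"
      have "exp (k * T) * exp (k * T) = exp (2 * k * T)" by (simp add: exp_add[symmetric] mult.assoc)
      also have "\<dots> = (l - k) / (l + k)" using pos k by (simp add: T_def)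
      finally have e: "exp (k * T) * exp (k * T) * (l + k) = l - k" using lk by (simp add: field_simps)
      have "?y T * (2 * k) * exp (k * T) = exp (k * T) * exp (k * T) * (l + k) - (l - k)"
        using k by (simp add: field_simps exp_minus)
      then have "?y T = 0" using e k by simp
      have "l\<^sup>2 + c = 0"
      proof (rule zero[of ?y ?z])
        show "(?y has_real_derivative ?z t) (at t)" for t
          using k by (auto intro!: derivative_eq_intros simp: field_simps)
        show "(?z has_real_derivative - c * ?y t) (at t)" for t
          using k by (auto intro!: derivative_eq_intros simp: field_simps)
      qed (use \<open>?y T = 0\<close> in simp_all)
      then show False using l2 k by (simp add: power2_eq_square)
    qed
  qed
qed

section \<open>The traces as global functions\<close>

context geodesic_field
begin

text \<open>A flow line may leave every chart, so the traces must be functions on all of the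
  manifold. The chosen chart may jump from point to point; by \<open>nabla_trace_eq\<close> it can
  be replaced by a fixed one near any given time.\<close>

definition chart_around :: "'a \<Rightarrow> ('a, 'n) chart" where
  "chart_around p = (SOME C. C \<in> A \<and> p \<in> fst C)"

lemma chart_around:
  assumes "p \<in> topspace M"
  shows "chart_around p \<in> A" "p \<in> fst (chart_around p)"
proof -
  obtain U \<phi> where "(U, \<phi>) \<in> A" "p \<in> U" by (rule chart_at[OF assms])
  then have "\<exists>C. C \<in> A \<and> p \<in> fst C" by force
  from someI_ex[OF this] show "chart_around p \<in> A" "p \<in> fst (chart_around p)"
    by (simp_all add: chart_around_def)
qed

definition nabla_trace :: "'a \<Rightarrow> real" where
  "nabla_trace p = trace (chart_matrix (chart_around p) p)"

definition nabla_trace_sq :: "'a \<Rightarrow> real" where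
  "nabla_trace_sq p = trace (chart_matrix (chart_around p) p ** chart_matrix (chart_around p) p)"

lemma nabla_trace_eq:
  assumes C: "(U, \<phi>) \<in> A" and p: "p \<in> U"
  shows "nabla_trace p = trace (chart_matrix (U, \<phi>) p)"
    and "nabla_trace_sq p = trace (chart_matrix (U, \<phi>) p ** chart_matrix (U, \<phi>) p)"
proof -
  have pM: "p \<in> topspace M" using chart_openin[OF C] openin_subset p by blast
  obtain V \<psi> where V: "chart_around p = (V, \<psi>)" by (cases "chart_around p")
  have D: "(V, \<psi>) \<in> A" "p \<in> V" using chart_around[OF pM] by (simp_all add: V)
  show "nabla_trace p = trace (chart_matrix (U, \<phi>) p)"
    "nabla_trace_sq p = trace (chart_matrix (U, \<phi>) p ** chart_matrix (U, \<phi>) p)"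
    using trace_chart_matrix_eq[OF C D(1) p D(2)] by (simp_all add: nabla_trace_def nabla_trace_sq_def V)
qed

end

context space_form_geodesic_field
begin

text \<open>The cubic trace is left in terms of some chart at the single point
  \<open>\<gamma> t\<close>, since \<open>trace_cube_3\<close> will eliminate it there. The curve
  stays in that chart for times near \<open>t\<close>, which suffices for a derivative.\<close>

lemma nabla_trace_deriv:
  assumes n: "CARD('n) = 3"
    and \<gamma>: "smooth_curve_on M A UNIV \<gamma>" "velocity M A \<gamma> t = X (\<gamma> t)"
  shows "((\<lambda>s. nabla_trace (\<gamma> s)) has_real_derivative - nabla_trace_sq (\<gamma> t) - 2 * c) (at t)"
    and "\<exists>U \<phi>. (U, \<phi>) \<in> A \<and> \<gamma> t \<in> U \<and>
     ((\<lambda>s. nabla_trace_sq (\<gamma> s)) has_real_derivative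
      - 2 * (trace (chart_matrix (U, \<phi>) (\<gamma> t) ** chart_matrix (U, \<phi>) (\<gamma> t) ** chart_matrix (U, \<phi>) (\<gamma> t))
        + c * nabla_trace (\<gamma> t))) (at t)"
proof -
  have "\<gamma> t \<in> topspace M" using \<gamma> by (auto simp: smooth_curve_on_def continuous_map_def)
  then obtain U \<phi> where C: "(U, \<phi>) \<in> A" "\<gamma> t \<in> U" by (rule chart_at)
  have "openin (top_of_set UNIV) {s \<in> topspace (top_of_set UNIV). \<gamma> s \<in> U}"
    using \<gamma> chart_openin[OF C(1)] unfolding smooth_curve_on_def
    by (intro openin_continuous_map_preimage) auto
  then have o: "open {s. \<gamma> s \<in> U}" by simp
  note d = trace_chart_matrix_deriv[OF C(1) \<gamma> C(2), unfolded n]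
  show "((\<lambda>s. nabla_trace (\<gamma> s)) has_real_derivative - nabla_trace_sq (\<gamma> t) - 2 * c) (at t)"
    using has_field_derivative_transform_within_open[OF d(1) o, of "\<lambda>s. nabla_trace (\<gamma> s)"]
      nabla_trace_eq[OF C(1)] C(2) by (simp add: mult.commute)
  show "\<exists>U \<phi>. (U, \<phi>) \<in> A \<and> \<gamma> t \<in> U \<and>
     ((\<lambda>s. nabla_trace_sq (\<gamma> s)) has_real_derivative
      - 2 * (trace (chart_matrix (U, \<phi>) (\<gamma> t) ** chart_matrix (U, \<phi>) (\<gamma> t) ** chart_matrix (U, \<phi>) (\<gamma> t))
        + c * nabla_trace (\<gamma> t))) (at t)"
    using has_field_derivative_transform_within_open[OF d(2) o, of "\<lambda>s. nabla_trace_sq (\<gamma> s)"]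
      nabla_trace_eq[OF C(1)] C by auto
qed

end

section \<open>Dimension three: the closed system and the eigenvalue bound\<close>

locale space_form_3 = space_form_geodesic_field M A g nabla X c
  for M :: "'a topology" and A :: "('a, 3) chart set" and g nabla X c
begin

text \<open>The full matrix has the eigenvalue 0 in the direction of \<open>X\<close>, so its second
  symmetric function \<open>d\<close> is the determinant of \<beta>. Eliminating the cubic trace
  with \<open>trace_cube_3\<close> and the quadratic one with tr B^2 = h^2 - 2 d leaves only
  \<open>h\<close> and \<open>d\<close>.\<close>

lemma nabla_det_deriv:
  assumes \<gamma>: "smooth_curve_on M A UNIV \<gamma>" "velocity M A \<gamma> t = X (\<gamma> t)"
  defines "h \<equiv> \<lambda>s. nabla_trace (\<gamma> s)"
    and "d \<equiv> \<lambda>s. ((nabla_trace (\<gamma> s))\<^sup>2 - nabla_trace_sq (\<gamma> s)) / 2"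
  shows "(h has_real_derivative 2 * d t - (h t)\<^sup>2 - 2 * c) (at t)"
    and "(d has_real_derivative - h t * (d t + c)) (at t)"
proof -
  have n: "CARD(3) = 3" by simp
  have d2: "2 * d t = (h t)\<^sup>2 - nabla_trace_sq (\<gamma> t)" by (simp add: h_def d_def)
  show h: "(h has_real_derivative 2 * d t - (h t)\<^sup>2 - 2 * c) (at t)"
    unfolding d2 using nabla_trace_deriv(1)[OF n \<gamma>] by (simp add: h_def)
  obtain U \<phi> where C: "(U, \<phi>) \<in> A" "\<gamma> t \<in> U" and
    d: "((\<lambda>s. nabla_trace_sq (\<gamma> s)) has_real_derivative
      - 2 * (trace (chart_matrix (U, \<phi>) (\<gamma> t) ** chart_matrix (U, \<phi>) (\<gamma> t) ** chart_matrix (U, \<phi>) (\<gamma> t))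
        + c * nabla_trace (\<gamma> t))) (at t)"
    using nabla_trace_deriv(2)[OF n \<gamma>] by blast
  have "trace (chart_matrix (U, \<phi>) (\<gamma> t) ** chart_matrix (U, \<phi>) (\<gamma> t) ** chart_matrix (U, \<phi>) (\<gamma> t)) =
      h t * nabla_trace_sq (\<gamma> t) - d t * h t"
    using trace_cube_3[OF det_chart_matrix[OF C]] nabla_trace_eq[OF C] by (simp add: h_def d_def)
  with d have "((\<lambda>s. nabla_trace_sq (\<gamma> s)) has_real_derivative
      - 2 * (h t * nabla_trace_sq (\<gamma> t) - d t * h t + c * h t)) (at t)"
    by (simp add: h_def)
  moreover have "nabla_trace_sq (\<gamma> t) = (h t)\<^sup>2 - 2 * d t" using d2 by simp
  ultimately have "((\<lambda>s. ((h s)\<^sup>2 - nabla_trace_sq (\<gamma> s)) / 2) has_real_derivative - h t * (d t + c)) (at t)"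
    using h by (auto intro!: derivative_eq_intros simp: power2_eq_square field_simps)
  then show "(d has_real_derivative - h t * (d t + c)) (at t)" by (simp add: h_def d_def)
qed

lemma eigenvalue_char_eq:
  assumes p: "p \<in> topspace M" and v: "v \<in> tangent_space M A p" "g p v (X p) = 0" "v \<noteq> tzero"
    and l: "nabla p v X = tscale l v"
  shows "l\<^sup>2 - l * nabla_trace p + ((nabla_trace p)\<^sup>2 - nabla_trace_sq p) / 2 = 0"
proof -
  obtain U \<phi> where C: "(U, \<phi>) \<in> A" "p \<in> U" by (rule chart_at[OF p])
  note Xt = X_tangent[OF p]
  let ?co = "\<lambda>w. (\<chi> i. w (\<lambda>q. \<phi> q $ i)) :: real ^ 3"
  show ?thesis
    unfolding nabla_trace_eq[OF C]
  proof (rule left_eigenvalue_3[of "?co v" _ _ "?co (X p)"])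
    show "(\<Sum>i\<in>UNIV. ?co v $ i * chart_matrix (U, \<phi>) p $ i $ j) = l * ?co v $ j" for j
      using nabla_X_coordinate[OF C v(1), of j] by (simp add: l)
    show "(\<Sum>i\<in>UNIV. ?co (X p) $ i * chart_matrix (U, \<phi>) p $ i $ j) = 0" for j
      using nabla_X_coordinate[OF C Xt, of j] by (simp add: X_geodesic[OF p])
    \<comment> \<open>\<open>v\<close> is nonzero and orthogonal to the unit vector
      \<open>X p\<close>, hence independent of it: pairing a relation with \<open>X p\<close>
      isolates \<open>b\<close>.\<close>
    fix a b assume "a *\<^sub>R ?co v + b *\<^sub>R ?co (X p) = 0"
    then have ab: "a * v (\<lambda>q. \<phi> q $ i) + b * X p (\<lambda>q. \<phi> q $ i) = 0" for i by (simp add: vec_eq_iff)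
    let ?w = "tadd (tscale a v) (tscale b (X p))"
    note av = tangent_scale[OF p v(1), of a] and bX = tangent_scale[OF p Xt, of b]
    have "?w \<in> tangent_space M A p" by (rule tangent_add[OF p av bX])
    from frame_expand[OF C this] have w: "?w = tzero" by (simp add: ab)
    have "g p ?w (X p) = b"
      using metric_add_left[OF p av bX Xt] metric_scale_left[OF p v(1) Xt, of a]
        metric_scale_left[OF p Xt Xt, of b] v(2) X_unit[OF p] by simp
    then have b: "b = 0" unfolding w using metric_zero_left[OF p Xt] by simp
    obtain f where "v f \<noteq> 0" using v(3) by auto
    moreover have "a * v f = 0" using fun_cong[OF w, of f] by (simp add: b)
    ultimately show "a = 0 \<and> b = 0" using b by simp
  qed
qed

lemma real_eigenvalue_bound:
  assumes complete: "complete_vector_field M A X" and p: "p \<in> topspace M"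
    and l: "real_eigenvalue (orth_complement M A g X p) (\<beta> nabla X p) l"
  shows "l\<^sup>2 \<le> - c"
proof -
  obtain \<gamma> where \<gamma>: "smooth_curve_on M A UNIV \<gamma>" "\<gamma> 0 = p" "\<And>t. velocity M A \<gamma> t = X (\<gamma> t)"
    using complete p unfolding complete_vector_field_def by metis
  obtain v where v: "v \<in> tangent_space M A p" "g p v (X p) = 0" "v \<noteq> tzero" "nabla p v X = tscale l v"
    using l by (auto simp: real_eigenvalue_def orth_complement_def \<beta>_def)
  show ?thesis
    using riccati_real_eigenvalue[OF nabla_det_deriv[OF \<gamma>(1,3)]] eigenvalue_char_eq[OF p v] \<gamma>(2)
    by simp
qed

end

theorem theorem5p1:
  fixes M :: "'a topology" and A :: "('a, 3) chart set"
    and g :: "'a metric_tensor" and nabla :: "'a covariant_derivative"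
    and X :: "'a \<Rightarrow> 'a tvec" and c :: real
  assumes "riemannian_manifold M A g"
    and "levi_civita_connection M A g nabla"
    and "constant_sectional_curvature M A g nabla c"
    and "geodesic_vector_field M A g nabla X"
    and "complete_vector_field M A X"
  shows "\<forall>p\<in>topspace M.
    (c > 0 \<longrightarrow> \<not> (\<exists>l. real_eigenvalue (orth_complement M A g X p) (\<beta> nabla X p) l)) \<and>
    (c = 0 \<longrightarrow> (\<forall>l. real_eigenvalue (orth_complement M A g X p) (\<beta> nabla X p) l \<longrightarrow> l = 0)) \<and>
    (c < 0 \<longrightarrow> (\<forall>l. real_eigenvalue (orth_complement M A g X p) (\<beta> nabla X p) l \<longrightarrow> \<bar>l\<bar> \<le> sqrt \<bar>c\<bar>))"
proof (intro ballI)
  fix p assume p: "p \<in> topspace M"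
  interpret space_form_3 M A g nabla X c
    by unfold_locales (use assms in \<open>simp_all add: riemannian_manifold_def\<close>)
  note bound = real_eigenvalue_bound[OF assms(5) p]
  have "\<not> real_eigenvalue (orth_complement M A g X p) (\<beta> nabla X p) l" if "c > 0" for l
  proof
    assume "real_eigenvalue (orth_complement M A g X p) (\<beta> nabla X p) l"
    from bound[OF this] show False using zero_le_power2[of l] that by linarith
  qed
  moreover have "l = 0" if "c = 0" "real_eigenvalue (orth_complement M A g X p) (\<beta> nabla X p) l" for l
    using bound[OF that(2)] that(1) by simp
  moreover have "\<bar>l\<bar> \<le> sqrt \<bar>c\<bar>"
    if "c < 0" "real_eigenvalue (orth_complement M A g X p) (\<beta> nabla X p) l" for l
    using real_sqrt_le_mono[OF bound[OF that(2)]] that(1) by simp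
  ultimately show "(c > 0 \<longrightarrow> \<not> (\<exists>l. real_eigenvalue (orth_complement M A g X p) (\<beta> nabla X p) l)) \<and>
    (c = 0 \<longrightarrow> (\<forall>l. real_eigenvalue (orth_complement M A g X p) (\<beta> nabla X p) l \<longrightarrow> l = 0)) \<and>
    (c < 0 \<longrightarrow> (\<forall>l. real_eigenvalue (orth_complement M A g X p) (\<beta> nabla X p) l \<longrightarrow> \<bar>l\<bar> \<le> sqrt \<bar>c\<bar>))"
    by blast
qed

end
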